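(* Let $\mathscr A$ be a profinitary and cofinitary exact category, and let $V_{\mathscr A}=\{v\in H_{\mathscr A}:\Delta(v)=v\otimes 1+1\otimes v\}$ be the space of primitive elements of its Hall algebra $H_{\mathscr A}$. Then $H_{\mathscr A}$ is generated by $V_{\mathscr A}$ as a unital $\mathbb Q$-algebra. Moreover, $V_{\mathscr A}$ is minimal in the sense that a non-zero element of $V_{\mathscr A}$ cannot be expressed as a sum of products of two or more elements of $V_{\mathscr A}$, that is, $V_{\mathscr A}\cap\sum_{r\ge 2}V_{\mathscr A}^r=\{0\}$.
   Context: All categories are essentially small; exact categories are in the sense of Quillen. $\mathrm{Iso}\,\mathscr A$ is the set of isomorphism classes $[X]$ of objects, an abelian monoid under $[X]+[Y]=[X\oplus Y]$. $\underline{\mathrm{Ext}}^1_{\mathscr A}(A,B)$ is the set of all $[X]$ such that there is a short exact sequence $B\rightarrowtail X\twoheadrightarrow A$. The Grothendieck monoid $\Gamma_{\mathscr A}$ is the quotient of $\mathrm{Iso}\,\mathscr A$ by the congruence which is the transitive closure of: $[X]\equiv[Y]$ if $[X],[Y]\in\underline{\mathrm{Ext}}^1_{\mathscr A}(M,N)$ for some $M,N$; $|X|$ is the image of $X$ in $\Gamma_{\mathscr A}$ and $\mathrm{Iso}\,\mathscr A_\gamma=\{[X]:|X|=\gamma\}$. A Hom-finite exact category (all Hom sets finite) is profinitary if $\mathrm{Iso}\,\mathscr A_\gamma$ is finite for all $\gamma\in\Gamma_{\mathscr A}$, and cofinitary if for every $[X]$ the set of pairs $([A],[B])$ with $[X]\in\underline{\mathrm{Ext}}^1_{\mathscr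 A}(A,B)$ is finite. Let $\mathcal E(A,B)_X$ be the set of all short exact sequences $B\rightarrowtail X\twoheadrightarrow A$ and $F_{A,B}^X=\#\mathcal E(A,B)_X/(\#\mathrm{Aut}_{\mathscr A}A\cdot\#\mathrm{Aut}_{\mathscr A}B)$. The Hall algebra $H_{\mathscr A}$ is the $\mathbb Q$-vector space with basis $\mathrm{Iso}\,\mathscr A$, product $[A]\cdot[B]=\sum_{[C]}F_{A,B}^C[C]$ and unit $1=[0]$. It carries the coproduct $\Delta([C])=\sum_{[A],[B]}F^{A,B}_C\,[A]\otimes[B]$, where $F^{A,B}_C=\frac{\#\mathrm{Aut}_{\mathscr A}A\cdot\#\mathrm{Aut}_{\mathscr A}B}{\#\mathrm{Aut}_{\mathscr A}C}F_{B,A}^C$ (a finite sum since $\mathscr A$ is cofinitary), and counit $\varepsilon([C])=\delta_{[0],[C]}$. ($\Delta$ need not be an algebra homomorphism.) $V^r$ denotes the span of all products of $r$ elements of $V$. *)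

theory Defs
  imports
    Complex_Main
    "HOL-Algebra.Group"
    "HOL-Library.Poly_Mapping"
begin

section \<open>Exact categories\<close>

text \<open>Categories are given by a set of objects and a set of arrows, each arrow having one
  domain and one codomain; \<open>g \<star> f\<close> is \<open>g\<close> after \<open>f\<close> and is meaningful only if
  \<open>Cod f = Dom g\<close>.\<close>

record ('o, 'm) category =
  Obj :: "'o set"
  Arr :: "'m set"
  Dom :: "'m \<Rightarrow> 'o"
  Cod :: "'m \<Rightarrow> 'o"
  Id :: "'o \<Rightarrow> 'm"
  Comp :: "'m \<Rightarrow> 'm \<Rightarrow> 'm" (infixr \<open>\<star>\<index>\<close> 75)

definition Hom :: "('o, 'm, 'z) category_scheme \<Rightarrow> 'o \<Rightarrow> 'o \<Rightarrow> 'm set" where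
  "Hom C X Y = {f \<in> Arr C. Dom C f = X \<and> Cod C f = Y}"

locale category =
  fixes C (structure)
  assumes dom_in_obj: "f \<in> Arr C \<Longrightarrow> Dom C f \<in> Obj C"
    and cod_in_obj: "f \<in> Arr C \<Longrightarrow> Cod C f \<in> Obj C"
    and id_in_hom: "X \<in> Obj C \<Longrightarrow> Id C X \<in> Hom C X X"
    and comp_in_hom: "\<lbrakk>f \<in> Hom C X Y; g \<in> Hom C Y Z\<rbrakk> \<Longrightarrow> g \<star> f \<in> Hom C X Z"
    and comp_id_right: "f \<in> Hom C X Y \<Longrightarrow> f \<star> Id C X = f"
    and comp_id_left: "f \<in> Hom C X Y \<Longrightarrow> Id C Y \<star> f = f"
    and comp_assoc: "\<lbrakk>f \<in> Hom C W X; g \<in> Hom C X Y; h \<in> Hom C Y Z\<rbrakk>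
      \<Longrightarrow> (h \<star> g) \<star> f = h \<star> (g \<star> f)"

definition iso_arr :: "('o, 'm, 'z) category_scheme \<Rightarrow> 'o \<Rightarrow> 'o \<Rightarrow> 'm set" where
  "iso_arr C X Y = {f \<in> Hom C X Y. \<exists>g \<in> Hom C Y X.
     Comp C g f = Id C X \<and> Comp C f g = Id C Y}"

definition Aut :: "('o, 'm, 'z) category_scheme \<Rightarrow> 'o \<Rightarrow> 'm set" where
  "Aut C X = iso_arr C X X"

definition zero_object :: "('o, 'm, 'z) category_scheme \<Rightarrow> 'o \<Rightarrow> bool" where
  "zero_object C Z \<longleftrightarrow> Z \<in> Obj C \<and>
     (\<forall>X \<in> Obj C. (\<exists>!f. f \<in> Hom C Z X) \<and> (\<exists>!f. f \<in> Hom C X Z))"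

record ('o, 'm) additive_category = "('o, 'm) category" +
  Add :: "'m \<Rightarrow> 'm \<Rightarrow> 'm" (infixl \<open>\<boxplus>\<index>\<close> 65)
  Zero :: "'o \<Rightarrow> 'o \<Rightarrow> 'm"

locale additive_category = category C
  for C :: "('o, 'm, 'z) additive_category_scheme" (structure) +
  assumes hom_group: "\<lbrakk>X \<in> Obj C; Y \<in> Obj C\<rbrakk>
      \<Longrightarrow> comm_group \<lparr>carrier = Hom C X Y, mult = Add C, one = Zero C X Y\<rparr>"
    and comp_add_right: "\<lbrakk>f \<in> Hom C X Y; f' \<in> Hom C X Y; g \<in> Hom C Y Z\<rbrakk>
      \<Longrightarrow> g \<star> (f \<boxplus> f') = (g \<star> f) \<boxplus> (g \<star> f')"
    and comp_add_left: "\<lbrakk>f \<in> Hom C X Y; g \<in> Hom C Y Z; g' \<in> Hom C Y Z\<rbrakk>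
      \<Longrightarrow> (g \<boxplus> g') \<star> f = (g \<star> f) \<boxplus> (g' \<star> f)"
    and has_zero_object: "\<exists>Z. zero_object C Z"
    and has_biproducts: "\<lbrakk>X \<in> Obj C; Y \<in> Obj C\<rbrakk> \<Longrightarrow>
      \<exists>S \<in> Obj C. \<exists>i \<in> Hom C X S. \<exists>j \<in> Hom C Y S. \<exists>p \<in> Hom C S X. \<exists>q \<in> Hom C S Y.
        p \<star> i = Id C X \<and> q \<star> j = Id C Y \<and> p \<star> j = Zero C Y X \<and> q \<star> i = Zero C X Y \<and>
        (i \<star> p) \<boxplus> (j \<star> q) = Id C S"

definition kernel_of ::
  "('o, 'm, 'z) additive_category_scheme \<Rightarrow> 'm \<Rightarrow> 'm \<Rightarrow> bool" where
  "kernel_of C i p \<longleftrightarrow> i \<in> Arr C \<and> p \<in> Arr C \<and> Cod C i = Dom C p \<and>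
     Comp C p i = Zero C (Dom C i) (Cod C p) \<and>
     (\<forall>T \<in> Obj C. \<forall>t \<in> Hom C T (Dom C p). Comp C p t = Zero C T (Cod C p) \<longrightarrow>
        (\<exists>!s. s \<in> Hom C T (Dom C i) \<and> Comp C i s = t))"

definition cokernel_of ::
  "('o, 'm, 'z) additive_category_scheme \<Rightarrow> 'm \<Rightarrow> 'm \<Rightarrow> bool" where
  "cokernel_of C p i \<longleftrightarrow> i \<in> Arr C \<and> p \<in> Arr C \<and> Cod C i = Dom C p \<and>
     Comp C p i = Zero C (Dom C i) (Cod C p) \<and>
     (\<forall>T \<in> Obj C. \<forall>t \<in> Hom C (Cod C i) T. Comp C t i = Zero C (Dom C i) T \<longrightarrow>
        (\<exists>!s. s \<in> Hom C (Cod C p) T \<and> Comp C s p = t))"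

text \<open>\<open>pushout C i f i' f'\<close>: the square \<open>f' \<star> i = i' \<star> f\<close> is cocartesian, so that \<open>i'\<close> is the
  pushout of \<open>i\<close> along \<open>f\<close>. Dually, \<open>pullback C p f p' f'\<close>: the square \<open>p \<star> f' = f \<star> p'\<close> is
  cartesian, so that \<open>p'\<close> is the pullback of \<open>p\<close> along \<open>f\<close>.\<close>

definition pushout ::
  "('o, 'm, 'z) category_scheme \<Rightarrow> 'm \<Rightarrow> 'm \<Rightarrow> 'm \<Rightarrow> 'm \<Rightarrow> bool" where
  "pushout C i f i' f' \<longleftrightarrow> i \<in> Arr C \<and> f \<in> Arr C \<and> i' \<in> Arr C \<and> f' \<in> Arr C \<and>
     Dom C f = Dom C i \<and> Dom C f' = Cod C i \<and> Dom C i' = Cod C f \<and> Cod C f' = Cod C i' \<and>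
     Comp C f' i = Comp C i' f \<and>
     (\<forall>T \<in> Obj C. \<forall>u \<in> Hom C (Cod C i) T. \<forall>v \<in> Hom C (Cod C f) T.
        Comp C u i = Comp C v f \<longrightarrow>
        (\<exists>!w. w \<in> Hom C (Cod C i') T \<and> Comp C w f' = u \<and> Comp C w i' = v))"

definition pullback ::
  "('o, 'm, 'z) category_scheme \<Rightarrow> 'm \<Rightarrow> 'm \<Rightarrow> 'm \<Rightarrow> 'm \<Rightarrow> bool" where
  "pullback C p f p' f' \<longleftrightarrow> p \<in> Arr C \<and> f \<in> Arr C \<and> p' \<in> Arr C \<and> f' \<in> Arr C \<and>
     Cod C f = Cod C p \<and> Cod C f' = Dom C p \<and> Cod C p' = Dom C f \<and> Dom C f' = Dom C p' \<and>
     Comp C p f' = Comp C f p' \<and>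
     (\<forall>T \<in> Obj C. \<forall>u \<in> Hom C T (Dom C p). \<forall>v \<in> Hom C T (Dom C f).
        Comp C p u = Comp C f v \<longrightarrow>
        (\<exists>!w. w \<in> Hom C T (Dom C p') \<and> Comp C f' w = u \<and> Comp C p' w = v))"

text \<open>\<open>Ses\<close> is the class of short exact sequences, as pairs \<open>(i, p)\<close> of an admissible
  monomorphism \<open>i\<close> and an admissible epimorphism \<open>p\<close>.\<close>

record ('o, 'm) exact_category = "('o, 'm) additive_category" +
  Ses :: "('m \<times> 'm) set"

definition admissible_mono :: "('o, 'm, 'z) exact_category_scheme \<Rightarrow> 'm \<Rightarrow> bool" where
  "admissible_mono C i \<longleftrightarrow> (\<exists>p. (i, p) \<in> Ses C)"

definition admissible_epi :: "('o, 'm, 'z) exact_category_scheme \<Rightarrow> 'm \<Rightarrow> bool" where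
  "admissible_epi C p \<longleftrightarrow> (\<exists>i. (i, p) \<in> Ses C)"

text \<open>Quillen's exact categories, in the axiomatization of Keller and Buehler: Keller showed that
  Quillen's remaining axiom (on compositions \<open>p \<star> f\<close> that are admissible epimorphisms, and its
  dual) is a consequence of these, and so is the exactness of split sequences.\<close>

locale exact_category = additive_category C
  for C :: "('o, 'm, 'z) exact_category_scheme" (structure) +
  assumes ses_kernel_cokernel: "(i, p) \<in> Ses C \<Longrightarrow> kernel_of C i p \<and> cokernel_of C p i"
    and ses_iso_closed: "\<lbrakk>(i, p) \<in> Ses C; i' \<in> Hom C B' X'; p' \<in> Hom C X' A';
       b \<in> iso_arr C (Dom C i) B'; x \<in> iso_arr C (Dom C p) X'; a \<in> iso_arr C (Cod C p) A';
       x \<star> i = i' \<star> b; a \<star> p = p' \<star> x\<rbrakk> \<Longrightarrow> (i', p') \<in> Ses C"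
    and id_admissible_mono: "X \<in> Obj C \<Longrightarrow> admissible_mono C (Id C X)"
    and id_admissible_epi: "X \<in> Obj C \<Longrightarrow> admissible_epi C (Id C X)"
    and comp_admissible_mono: "\<lbrakk>admissible_mono C i; admissible_mono C j; Cod C i = Dom C j\<rbrakk>
       \<Longrightarrow> admissible_mono C (j \<star> i)"
    and comp_admissible_epi: "\<lbrakk>admissible_epi C p; admissible_epi C q; Cod C p = Dom C q\<rbrakk>
       \<Longrightarrow> admissible_epi C (q \<star> p)"
    and pushout_admissible_mono: "\<lbrakk>admissible_mono C i; f \<in> Arr C; Dom C f = Dom C i\<rbrakk>
       \<Longrightarrow> \<exists>i' f'. pushout C i f i' f' \<and> admissible_mono C i'"
    and pullback_admissible_epi: "\<lbrakk>admissible_epi C p; f \<in> Arr C; Cod C f = Cod C p\<rbrakk>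
       \<Longrightarrow> \<exists>p' f'. pullback C p f p' f' \<and> admissible_epi C p'"


section \<open>The Grothendieck monoid and finiteness conditions\<close>

definition iso_class :: "('o, 'm, 'z) category_scheme \<Rightarrow> 'o \<Rightarrow> 'o set" where
  "iso_class C X = {Y \<in> Obj C. iso_arr C X Y \<noteq> {}}"

definition Iso :: "('o, 'm, 'z) category_scheme \<Rightarrow> 'o set set" where
  "Iso C = iso_class C ` Obj C"

text \<open>The set of short exact sequences \<open>B \<rightarrow> X \<rightarrow> A\<close>; the end term \<open>A\<close> comes first.\<close>

definition ses_between ::
  "('o, 'm, 'z) exact_category_scheme \<Rightarrow> 'o \<Rightarrow> 'o \<Rightarrow> 'o \<Rightarrow> ('m \<times> 'm) set" where
  "ses_between C A B X = {(i, p) \<in> Ses C. i \<in> Hom C B X \<and> p \<in> Hom C X A}"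

definition Ext1 :: "('o, 'm, 'z) exact_category_scheme \<Rightarrow> 'o \<Rightarrow> 'o \<Rightarrow> 'o set set" where
  "Ext1 C A B = {iso_class C X | X. X \<in> Obj C \<and> ses_between C A B X \<noteq> {}}"

definition Grothendieck_cong :: "('o, 'm, 'z) exact_category_scheme \<Rightarrow> 'o set rel" where
  "Grothendieck_cong C =
     {(x, y). \<exists>M \<in> Obj C. \<exists>N \<in> Obj C. x \<in> Ext1 C M N \<and> y \<in> Ext1 C M N}\<^sup>+"

text \<open>Only the underlying set of the Grothendieck monoid is needed.\<close>

definition Grothendieck_monoid ::
  "('o, 'm, 'z) exact_category_scheme \<Rightarrow> 'o set set set" where
  "Grothendieck_monoid C = Iso C // Grothendieck_cong C"

definition Grothendieck_class ::
  "('o, 'm, 'z) exact_category_scheme \<Rightarrow> 'o set \<Rightarrow> 'o set set" where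
  "Grothendieck_class C x = Grothendieck_cong C `` {x}"

definition Iso_of_class ::
  "('o, 'm, 'z) exact_category_scheme \<Rightarrow> 'o set set \<Rightarrow> 'o set set" where
  "Iso_of_class C \<gamma> = {x \<in> Iso C. Grothendieck_class C x = \<gamma>}"

definition hom_finite :: "('o, 'm, 'z) category_scheme \<Rightarrow> bool" where
  "hom_finite C \<longleftrightarrow> (\<forall>X \<in> Obj C. \<forall>Y \<in> Obj C. finite (Hom C X Y))"

definition profinitary :: "('o, 'm, 'z) exact_category_scheme \<Rightarrow> bool" where
  "profinitary C \<longleftrightarrow> hom_finite C \<and>
     (\<forall>\<gamma> \<in> Grothendieck_monoid C. finite (Iso_of_class C \<gamma>))"

definition cofinitary :: "('o, 'm, 'z) exact_category_scheme \<Rightarrow> bool" where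
  "cofinitary C \<longleftrightarrow> hom_finite C \<and>
     (\<forall>x \<in> Iso C. finite {(iso_class C A, iso_class C B) | A B.
        A \<in> Obj C \<and> B \<in> Obj C \<and> x \<in> Ext1 C A B})"


section \<open>The Hall algebra\<close>

text \<open>A finitely supported function \<open>'i \<Rightarrow>\<^sub>0 rat\<close> is a formal rational linear combination of
  elements of \<open>'i\<close>, and \<open>Poly_Mapping.single\<close> embeds the basis.\<close>

definition scale :: "rat \<Rightarrow> ('i \<Rightarrow>\<^sub>0 rat) \<Rightarrow> ('i \<Rightarrow>\<^sub>0 rat)" where
  "scale c v = Poly_Mapping.map ((*) c) v"

lemma lookup_scale [simp]: "Poly_Mapping.lookup (scale c v) x = c * Poly_Mapping.lookup v x"
  by (simp add: scale_def Poly_Mapping.map.rep_eq when_def)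

global_interpretation hall: vector_space scale
  by standard (auto intro!: poly_mapping_eqI simp: lookup_add algebra_simps)

definition Hall_space :: "('o, 'm, 'z) category_scheme \<Rightarrow> ('o set \<Rightarrow>\<^sub>0 rat) set" where
  "Hall_space C = {v. Poly_Mapping.keys v \<subseteq> Iso C}"

text \<open>The Hall number \<open>F\<^sub>A\<^sub>B\<^sup>X\<close> and its dual version \<open>F\<^sup>A\<^sup>B\<^sub>X\<close> (note the exchange of \<open>A\<close> and \<open>B\<close>).\<close>

definition Hall_number ::
  "('o, 'm, 'z) exact_category_scheme \<Rightarrow> 'o \<Rightarrow> 'o \<Rightarrow> 'o \<Rightarrow> rat" where
  "Hall_number C A B X =
     of_nat (card (ses_between C A B X)) / of_nat (card (Aut C A) * card (Aut C B))"

definition dual_Hall_number ::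
  "('o, 'm, 'z) exact_category_scheme \<Rightarrow> 'o \<Rightarrow> 'o \<Rightarrow> 'o \<Rightarrow> rat" where
  "dual_Hall_number C A B X =
     of_nat (card (Aut C A) * card (Aut C B)) / of_nat (card (Aut C X)) * Hall_number C B A X"

text \<open>Hall numbers depend only on isomorphism classes, so they may be computed on arbitrarily
  chosen representatives.\<close>

definition rep :: "'o set \<Rightarrow> 'o" where
  "rep x = (SOME X. X \<in> x)"

text \<open>The index sets of the sums in the next two definitions are finite if the category is
  profinitary and cofinitary, respectively.\<close>

definition Hall_mult_basis ::
  "('o, 'm, 'z) exact_category_scheme \<Rightarrow> 'o set \<Rightarrow> 'o set \<Rightarrow> ('o set \<Rightarrow>\<^sub>0 rat)" where
  "Hall_mult_basis C a b =
     (\<Sum>c \<in> {c \<in> Iso C. Hall_number C (rep a) (rep b) (rep c) \<noteq> 0}.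
        Poly_Mapping.single c (Hall_number C (rep a) (rep b) (rep c)))"

definition Hall_comult_basis ::
  "('o, 'm, 'z) exact_category_scheme \<Rightarrow> 'o set \<Rightarrow> ('o set \<times> 'o set \<Rightarrow>\<^sub>0 rat)" where
  "Hall_comult_basis C c =
     (\<Sum>(a, b) \<in> {(a, b) \<in> Iso C \<times> Iso C. dual_Hall_number C (rep a) (rep b) (rep c) \<noteq> 0}.
        Poly_Mapping.single (a, b) (dual_Hall_number C (rep a) (rep b) (rep c)))"

definition Hall_mult ::
  "('o, 'm, 'z) exact_category_scheme \<Rightarrow>
     ('o set \<Rightarrow>\<^sub>0 rat) \<Rightarrow> ('o set \<Rightarrow>\<^sub>0 rat) \<Rightarrow> ('o set \<Rightarrow>\<^sub>0 rat)" where
  "Hall_mult C v w = (\<Sum>a \<in> Poly_Mapping.keys v. \<Sum>b \<in> Poly_Mapping.keys w.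
     scale (Poly_Mapping.lookup v a * Poly_Mapping.lookup w b) (Hall_mult_basis C a b))"

definition Hall_one :: "('o, 'm, 'z) exact_category_scheme \<Rightarrow> ('o set \<Rightarrow>\<^sub>0 rat)" where
  "Hall_one C = Poly_Mapping.single (iso_class C (SOME Z. zero_object C Z)) 1"

text \<open>The tensor square of the space with basis \<open>Iso C\<close> is realized as the space with basis
  \<open>Iso C \<times> Iso C\<close>.\<close>

definition tensor ::
  "('i \<Rightarrow>\<^sub>0 rat) \<Rightarrow> ('j \<Rightarrow>\<^sub>0 rat) \<Rightarrow> ('i \<times> 'j \<Rightarrow>\<^sub>0 rat)" where
  "tensor v w = (\<Sum>a \<in> Poly_Mapping.keys v. \<Sum>b \<in> Poly_Mapping.keys w.
     Poly_Mapping.single (a, b) (Poly_Mapping.lookup v a * Poly_Mapping.lookup w b))"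

definition Hall_comult ::
  "('o, 'm, 'z) exact_category_scheme \<Rightarrow>
     ('o set \<Rightarrow>\<^sub>0 rat) \<Rightarrow> ('o set \<times> 'o set \<Rightarrow>\<^sub>0 rat)" where
  "Hall_comult C v =
     (\<Sum>c \<in> Poly_Mapping.keys v. scale (Poly_Mapping.lookup v c) (Hall_comult_basis C c))"

definition Hall_primitives ::
  "('o, 'm, 'z) exact_category_scheme \<Rightarrow> ('o set \<Rightarrow>\<^sub>0 rat) set" where
  "Hall_primitives C =
     {v \<in> Hall_space C. Hall_comult C v = tensor v (Hall_one C) + tensor (Hall_one C) v}"

definition Hall_subalgebra ::
  "('o, 'm, 'z) exact_category_scheme \<Rightarrow> ('o set \<Rightarrow>\<^sub>0 rat) set \<Rightarrow> bool" where
  "Hall_subalgebra C S \<longleftrightarrow> S \<subseteq> Hall_space C \<and> hall.subspace S \<and> Hall_one C \<in> S \<and>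
     (\<forall>v \<in> S. \<forall>w \<in> S. Hall_mult C v w \<in> S)"

text \<open>\<open>V\<^sup>r\<close>, the span of all products of \<open>r\<close> elements of \<open>V\<close>.\<close>

definition Hall_power ::
  "('o, 'm, 'z) exact_category_scheme \<Rightarrow>
     ('o set \<Rightarrow>\<^sub>0 rat) set \<Rightarrow> nat \<Rightarrow> ('o set \<Rightarrow>\<^sub>0 rat) set" where
  "Hall_power C V r =
     hall.span {foldr (Hall_mult C) vs (Hall_one C) | vs. length vs = r \<and> set vs \<subseteq> V}"

end

theory Submission
  imports Defs
begin

text \<open>With respect to the form in which the classes \<open>[A]\<close> are orthogonal with square
  \<open>1 / #Aut A\<close>, the coproduct is adjoint to the opposite product. Hence the primitive elements are
  the orthogonal complement of the square of the augmentation ideal inside the augmentation ideal.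
  The Hall algebra is graded by the Grothendieck monoid, its graded pieces are finite-dimensional
  and the form is positive definite, so that every class is the sum of a primitive element and a
  combination of products of two non-zero classes. Minimality is immediate, and generation
  follows by induction once the grading is known to be well-founded. For the latter take
  \<open>deg [X]\<close> to be the maximum of \<open>#End Y\<close> over \<open>|Y| = |X|\<close>: if \<open>|X| = |A| + |B|\<close> and \<open>Y\<close> attains
  the maximum for \<open>A\<close>, then \<open>|Y \<oplus> B| = |X|\<close>, and \<open>Y \<oplus> B\<close> has more endomorphisms than \<open>Y\<close>
  if \<open>B \<noteq> 0\<close>.\<close>

section \<open>Categories and products\<close>

context category
begin

lemma Hom_iff: "f \<in> Hom C X Y \<longleftrightarrow> f \<in> Arr C \<and> Dom C f = X \<and> Cod C f = Y"
  by (auto simp: Hom_def)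

lemma Hom_Obj:
  assumes "f \<in> Hom C X Y"
  shows "X \<in> Obj C" "Y \<in> Obj C"
  using assms dom_in_obj cod_in_obj by (auto simp: Hom_iff)

lemma iso_arrE:
  assumes "f \<in> iso_arr C X Y"
  obtains g where "f \<in> Hom C X Y" "g \<in> Hom C Y X" "g \<star> f = Id C X" "f \<star> g = Id C Y"
    "g \<in> iso_arr C Y X"
  using assms unfolding iso_arr_def by blast

lemma iso_arrI:
  assumes "f \<in> Hom C X Y" "g \<in> Hom C Y X" "g \<star> f = Id C X" "f \<star> g = Id C Y"
  shows "f \<in> iso_arr C X Y"
  using assms unfolding iso_arr_def by blast

lemma Id_iso: "X \<in> Obj C \<Longrightarrow> Id C X \<in> iso_arr C X X"
  using iso_arrI[OF id_in_hom id_in_hom] comp_id_left[OF id_in_hom] by simp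

lemma comp_iso:
  assumes "f \<in> iso_arr C X Y" "g \<in> iso_arr C Y Z"
  shows "g \<star> f \<in> iso_arr C X Z"
proof -
  obtain f' where f: "f \<in> Hom C X Y" "f' \<in> Hom C Y X" "f' \<star> f = Id C X" "f \<star> f' = Id C Y"
    using assms(1) by (rule iso_arrE)
  obtain g' where g: "g \<in> Hom C Y Z" "g' \<in> Hom C Z Y" "g' \<star> g = Id C Y" "g \<star> g' = Id C Z"
    using assms(2) by (rule iso_arrE)
  show ?thesis
  proof (rule iso_arrI)
    show "g \<star> f \<in> Hom C X Z" "f' \<star> g' \<in> Hom C Z X"
      using f g by (auto intro: comp_in_hom)
    have "(f' \<star> g') \<star> (g \<star> f) = f' \<star> ((g' \<star> g) \<star> f)"
      using comp_assoc[OF comp_in_hom[OF f(1) g(1)] g(2) f(2)] comp_assoc[OF f(1) g(1,2)] by simp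
    then show "(f' \<star> g') \<star> (g \<star> f) = Id C X"
      using f(3) g(3) comp_id_left[OF f(1)] by simp
    have "(g \<star> f) \<star> (f' \<star> g') = g \<star> ((f \<star> f') \<star> g')"
      using comp_assoc[OF comp_in_hom[OF g(2) f(2)] f(1) g(1)] comp_assoc[OF g(2) f(2,1)] by simp
    then show "(g \<star> f) \<star> (f' \<star> g') = Id C Z"
      using f(4) g(4) comp_id_left[OF g(2)] by simp
  qed
qed

lemma iso_class_eq_iff:
  assumes "X \<in> Obj C" "Y \<in> Obj C"
  shows "iso_class C X = iso_class C Y \<longleftrightarrow> iso_arr C X Y \<noteq> {}"
proof
  assume "iso_class C X = iso_class C Y"
  moreover have "Y \<in> iso_class C Y"
    using assms Id_iso unfolding iso_class_def by blast
  ultimately show "iso_arr C X Y \<noteq> {}" unfolding iso_class_def by blast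
next
  assume "iso_arr C X Y \<noteq> {}"
  then obtain f g where "f \<in> iso_arr C X Y" "g \<in> iso_arr C Y X"
    by (meson ex_in_conv iso_arrE)
  then show "iso_class C X = iso_class C Y"
    unfolding iso_class_def using comp_iso by blast
qed

lemma rep_Iso:
  assumes "x \<in> Iso C"
  shows "rep x \<in> Obj C" "iso_class C (rep x) = x"
proof -
  obtain X where X: "X \<in> Obj C" "x = iso_class C X"
    using assms unfolding Iso_def by auto
  then have "X \<in> x" using Id_iso unfolding iso_class_def by blast
  then have *: "rep x \<in> x" unfolding rep_def by (rule someI)
  then show "rep x \<in> Obj C" using X unfolding iso_class_def by blast
  then show "iso_class C (rep x) = x"
    using * X iso_class_eq_iff[of X "rep x"] unfolding iso_class_def by blast
qed

text \<open>Conjugation \<open>f \<mapsto> i \<star> (f \<star> r)\<close> embeds the endomorphisms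
  of the retract \<open>A\<close> into those of \<open>S\<close>: composing further with
  \<open>r\<close> on the left and \<open>i\<close> on the right recovers \<open>f\<close>. If the
  identity of \<open>S\<close> is hit, then \<open>f\<close> must be the identity of
  \<open>A\<close>, so \<open>i \<star> r\<close> is the identity of \<open>S\<close>; otherwise the
  inequality is strict.\<close>

lemma
  assumes fin: "finite (Hom C S S)" and i: "i \<in> Hom C A S" and r: "r \<in> Hom C S A"
    and ri: "r \<star> i = Id C A"
  shows retract_card_End_le: "card (Hom C A A) \<le> card (Hom C S S)"
    and retract_card_End_less: "i \<star> r \<noteq> Id C S \<Longrightarrow> card (Hom C A A) < card (Hom C S S)"
proof -
  let ?h = "\<lambda>f. i \<star> (f \<star> r)"
  have retr: "r \<star> (?h f \<star> i) = f" if f: "f \<in> Hom C A A" for f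
  proof -
    have fr: "f \<star> r \<in> Hom C S A" by (rule comp_in_hom[OF r f])
    have "r \<star> (?h f \<star> i) = r \<star> (i \<star> ((f \<star> r) \<star> i))"
      using comp_assoc[OF i fr i] by simp
    also have "(f \<star> r) \<star> i = f" using comp_assoc[OF i r f] ri comp_id_right[OF f] by simp
    also have "r \<star> (i \<star> f) = f" using comp_assoc[OF f i r] ri comp_id_left[OF f] by simp
    finally show ?thesis .
  qed
  have inj: "inj_on ?h (Hom C A A)" by (rule inj_on_inverseI) (rule retr)
  have sub: "?h ` Hom C A A \<subseteq> Hom C S S" using i r comp_in_hom by blast
  show "card (Hom C A A) \<le> card (Hom C S S)" by (rule card_inj_on_le[OF inj sub fin])
  assume ir: "i \<star> r \<noteq> Id C S"
  have "Id C S \<notin> ?h ` Hom C A A"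
  proof
    assume "Id C S \<in> ?h ` Hom C A A"
    then obtain f where f: "f \<in> Hom C A A" "Id C S = ?h f" by blast
    then have "f = Id C A" using retr[OF f(1)] comp_id_left[OF i] ri by simp
    then show False using f(2) ir comp_id_left[OF r] by simp
  qed
  then have "?h ` Hom C A A \<subset> Hom C S S"
    using sub id_in_hom[OF Hom_Obj(2)[OF i]] by blast
  from psubset_card_mono[OF fin this] show "card (Hom C A A) < card (Hom C S S)"
    using card_image[OF inj] by simp
qed

end

text \<open>Direct sums enter through their universal property with the two projections, the form in
  which they can be compared with pullbacks.\<close>

definition product ::
  "('o, 'm, 'z) category_scheme \<Rightarrow> 'o \<Rightarrow> 'o \<Rightarrow> 'o \<Rightarrow> 'm \<Rightarrow> 'm \<Rightarrow> bool" where
  "product C S A B p q \<longleftrightarrow> p \<in> Hom C S A \<and> q \<in> Hom C S B \<and>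
     (\<forall>T \<in> Obj C. \<forall>u \<in> Hom C T A. \<forall>v \<in> Hom C T B.
        \<exists>!w. w \<in> Hom C T S \<and> Comp C p w = u \<and> Comp C q w = v)"

lemma product_commute:
  assumes "product C S A B p q"
  shows "product C S B A q p"
proof -
  have "\<exists>!w. w \<in> Hom C T S \<and> Comp C q w = v \<and> Comp C p w = u"
    if "T \<in> Obj C" "u \<in> Hom C T A" "v \<in> Hom C T B" for T u v
  proof -
    have "\<exists>!w. w \<in> Hom C T S \<and> Comp C p w = u \<and> Comp C q w = v"
      using assms that unfolding product_def by blast
    then show ?thesis by (simp only: conj_commute conj_left_commute)
  qed
  then show ?thesis using assms unfolding product_def by simp
qed

section \<open>Zero morphisms, zero objects and products in additive categories\<close>

context additive_category
begin

lemma Zero_in_Hom: "\<lbrakk>X \<in> Obj C; Y \<in> Obj C\<rbrakk> \<Longrightarrow> Zero C X Y \<in> Hom C X Y"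
  using hom_group[of X Y] monoid.one_closed[OF group.is_monoid[OF comm_group.axioms(2)]]
  by fastforce

lemma Add_in_Hom: "\<lbrakk>f \<in> Hom C X Y; g \<in> Hom C X Y\<rbrakk> \<Longrightarrow> f \<boxplus> g \<in> Hom C X Y"
  using hom_group[of X Y] Hom_Obj[of f X Y]
    monoid.m_closed[OF group.is_monoid[OF comm_group.axioms(2)]] by fastforce

lemma Add_Zero:
  assumes "f \<in> Hom C X Y"
  shows "f \<boxplus> Zero C X Y = f" "Zero C X Y \<boxplus> f = f"
  using hom_group[of X Y] Hom_Obj[OF assms] assms
    monoid.r_one[OF group.is_monoid[OF comm_group.axioms(2)]]
    monoid.l_one[OF group.is_monoid[OF comm_group.axioms(2)]] by fastforce+

lemma Add_idem_Zero:
  assumes "f \<in> Hom C X Y" "f \<boxplus> f = f"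
  shows "f = Zero C X Y"
  using hom_group[of X Y] Hom_Obj[OF assms(1)] assms
    group.r_cancel_one[OF comm_group.axioms(2)] by fastforce

text \<open>By biadditivity the composite is idempotent for addition, and the only such element of a
  group is the neutral one.\<close>

lemma comp_Zero_right:
  assumes "g \<in> Hom C Y Z" "X \<in> Obj C"
  shows "g \<star> Zero C X Y = Zero C X Z"
proof (rule Add_idem_Zero)
  have 0: "Zero C X Y \<in> Hom C X Y" using assms Hom_Obj Zero_in_Hom by blast
  then show "g \<star> Zero C X Y \<in> Hom C X Z" using assms comp_in_hom by blast
  show "(g \<star> Zero C X Y) \<boxplus> (g \<star> Zero C X Y) = g \<star> Zero C X Y"
    using comp_add_right[OF 0 0 assms(1)] Add_Zero[OF 0] by simp
qed

lemma comp_Zero_left: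
  assumes "f \<in> Hom C X Y" "Z \<in> Obj C"
  shows "Zero C Y Z \<star> f = Zero C X Z"
proof (rule Add_idem_Zero)
  have 0: "Zero C Y Z \<in> Hom C Y Z" using assms Hom_Obj Zero_in_Hom by blast
  then show "Zero C Y Z \<star> f \<in> Hom C X Z" using assms comp_in_hom by blast
  show "(Zero C Y Z \<star> f) \<boxplus> (Zero C Y Z \<star> f) = Zero C Y Z \<star> f"
    using comp_add_left[OF assms(1) 0 0] Add_Zero[OF 0] by simp
qed

text \<open>If the identity is zero, composing with it kills every arrow into or out of
  \<open>X\<close>. In this form zero objects can be detected by cancelling a monomorphism or an
  epimorphism.\<close>

lemma zero_object_iff: "zero_object C X \<longleftrightarrow> X \<in> Obj C \<and> Id C X = Zero C X X"
proof
  assume "zero_object C X"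
  then show "X \<in> Obj C \<and> Id C X = Zero C X X"
    unfolding zero_object_def by (metis Zero_in_Hom id_in_hom)
next
  assume X: "X \<in> Obj C \<and> Id C X = Zero C X X"
  have "f = Zero C X Y" if "f \<in> Hom C X Y" for f Y
    using comp_Zero_right[OF that, of X] comp_id_right[OF that] X by simp
  moreover have "f = Zero C Y X" if "f \<in> Hom C Y X" for f Y
    using comp_Zero_left[OF that, of X] comp_id_left[OF that] X by simp
  ultimately show "zero_object C X"
    unfolding zero_object_def using X Zero_in_Hom by blast
qed

lemma zero_object_Hom:
  assumes "zero_object C Z"
  shows "f \<in> Hom C Z X \<Longrightarrow> f = Zero C Z X" "f \<in> Hom C X Z \<Longrightarrow> f = Zero C X Z"
proof -
  show "f = Zero C Z X" if "f \<in> Hom C Z X"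
    using assms that Hom_Obj[OF that] Zero_in_Hom[of Z X] unfolding zero_object_def by blast
  show "f = Zero C X Z" if "f \<in> Hom C X Z"
    using assms that Hom_Obj[OF that] Zero_in_Hom[of X Z] unfolding zero_object_def by blast
qed

lemma zero_object_iso:
  assumes "zero_object C Z" "zero_object C Z'"
  shows "Zero C Z Z' \<in> iso_arr C Z Z'"
  using assms by (intro iso_arrI[of _ _ _ "Zero C Z' Z"])
    (auto simp: zero_object_iff Zero_in_Hom comp_Zero_right)

lemma iso_zero_object:
  assumes "zero_object C Z" "f \<in> iso_arr C Z X"
  shows "zero_object C X"
proof -
  obtain g where g: "f \<in> Hom C Z X" "g \<in> Hom C X Z" "f \<star> g = Id C X"
    using assms(2) by (rule iso_arrE)
  then have "f = Zero C Z X" using assms(1) zero_object_Hom by blast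
  then show ?thesis using g comp_Zero_left[OF g(2)] Hom_Obj zero_object_iff by metis
qed

lemma iso_class_zero:
  assumes "zero_object C Z" "X \<in> Obj C"
  shows "iso_class C X = iso_class C Z \<longleftrightarrow> zero_object C X"
  by (metis assms empty_iff ex_in_conv iso_class_eq_iff iso_zero_object zero_object_iff
      zero_object_iso)

text \<open>The biproduct of the axioms serves: the arrow with components \<open>u\<close> and
  \<open>v\<close> is the sum of \<open>i \<star> u\<close> and \<open>j \<star> v\<close>, and
  uniqueness follows by inserting the decomposition of \<open>Id C S\<close>.\<close>

lemma ex_product:
  assumes "A \<in> Obj C" "B \<in> Obj C"
  obtains S p q where "product C S A B p q"
proof -
  obtain S i j p q where b: "S \<in> Obj C" "i \<in> Hom C A S" "j \<in> Hom C B S" "p \<in> Hom C S A"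
    "q \<in> Hom C S B" "p \<star> i = Id C A" "q \<star> j = Id C B" "p \<star> j = Zero C B A" "q \<star> i = Zero C A B"
    "(i \<star> p) \<boxplus> (j \<star> q) = Id C S"
    using has_biproducts[OF assms] by blast
  have "\<exists>!w. w \<in> Hom C T S \<and> p \<star> w = u \<and> q \<star> w = v"
    if T: "T \<in> Obj C" and u: "u \<in> Hom C T A" and v: "v \<in> Hom C T B" for T u v
  proof
    have iu: "i \<star> u \<in> Hom C T S" and jv: "j \<star> v \<in> Hom C T S"
      using b u v comp_in_hom by blast+
    have "p \<star> (i \<star> u) = u" "q \<star> (j \<star> v) = v" "p \<star> (j \<star> v) = Zero C T A" "q \<star> (i \<star> u) = Zero C T B"
      using b u v T assms comp_assoc[symmetric] by (simp_all add: comp_id_left comp_Zero_left)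
    then show "(i \<star> u) \<boxplus> (j \<star> v) \<in> Hom C T S \<and> p \<star> ((i \<star> u) \<boxplus> (j \<star> v)) = u \<and>
        q \<star> ((i \<star> u) \<boxplus> (j \<star> v)) = v"
      using comp_add_right[OF iu jv b(4)] comp_add_right[OF iu jv b(5)] Add_in_Hom[OF iu jv]
        Add_Zero[OF u] Add_Zero[OF v] by simp
    fix w assume "w \<in> Hom C T S \<and> p \<star> w = u \<and> q \<star> w = v"
    then have w: "w \<in> Hom C T S" "p \<star> w = u" "q \<star> w = v" by auto
    have "w = ((i \<star> p) \<boxplus> (j \<star> q)) \<star> w" using b(10) comp_id_left[OF w(1)] by simp
    also have "\<dots> = ((i \<star> p) \<star> w) \<boxplus> ((j \<star> q) \<star> w)"
      by (rule comp_add_left[OF w(1) comp_in_hom[OF b(4,2)] comp_in_hom[OF b(5,3)]])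
    also have "\<dots> = (i \<star> u) \<boxplus> (j \<star> v)"
      using comp_assoc[OF w(1) b(4,2)] comp_assoc[OF w(1) b(5,3)] w by simp
    finally show "w = (i \<star> u) \<boxplus> (j \<star> v)" .
  qed
  then have "product C S A B p q" unfolding product_def using b by blast
  then show thesis by (rule that)
qed

text \<open>\<open>A\<close> is a retract of \<open>S\<close> through the section with components
  identity and zero. Were \<open>i \<star> p\<close> the identity, the projection \<open>q\<close>
  would be zero although it has the section \<open>j\<close>, and \<open>B\<close> would be a zero
  object.\<close>

lemma product_card_End:
  assumes S: "product C S A B p q" and fin: "finite (Hom C S S)" and B: "\<not> zero_object C B"
  shows "card (Hom C A A) < card (Hom C S S)"
proof -
  have pq: "p \<in> Hom C S A" "q \<in> Hom C S B" using S unfolding product_def by auto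
  then have obj: "S \<in> Obj C" "A \<in> Obj C" "B \<in> Obj C" using Hom_Obj by auto
  obtain i where i: "i \<in> Hom C A S" "p \<star> i = Id C A" "q \<star> i = Zero C A B"
    using S obj id_in_hom Zero_in_Hom unfolding product_def by meson
  obtain j where j: "j \<in> Hom C B S" "q \<star> j = Id C B"
    using S obj id_in_hom Zero_in_Hom unfolding product_def by meson
  have "i \<star> p \<noteq> Id C S"
  proof
    assume *: "i \<star> p = Id C S"
    have "q = q \<star> (i \<star> p)" using * comp_id_right[OF pq(2)] by simp
    also have "\<dots> = Zero C S B"
      using comp_assoc[OF pq(1) i(1) pq(2)] i comp_Zero_left[OF pq(1) obj(3)] by simp
    finally have "Id C B = Zero C B B" using j comp_Zero_left[OF j(1) obj(3)] by simp
    then show False using B obj zero_object_iff by blast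
  qed
  then show ?thesis using retract_card_End_less[OF fin i(1) pq(1) i(2)] by blast
qed

section \<open>Kernels and cokernels: cancellation, factorisation, uniqueness\<close>

lemma kernel_mono:
  assumes "kernel_of C i p" "s \<in> Hom C T (Dom C i)" "t \<in> Hom C T (Dom C i)" "i \<star> s = i \<star> t"
  shows "s = t"
proof -
  have ip: "i \<in> Hom C (Dom C i) (Dom C p)" "p \<in> Hom C (Dom C p) (Cod C p)"
    and 0: "p \<star> i = Zero C (Dom C i) (Cod C p)"
    using assms(1) by (auto simp: kernel_of_def Hom_iff)
  have T: "T \<in> Obj C" using Hom_Obj assms(2) by blast
  have comp: "i \<star> s \<in> Hom C T (Dom C p)" using ip assms comp_in_hom by blast
  have "p \<star> (i \<star> s) = Zero C T (Cod C p)"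
    using comp_assoc[OF assms(2) ip] 0 comp_Zero_left[OF assms(2)] Hom_Obj(2)[OF ip(2)] by simp
  then have "\<exists>!r. r \<in> Hom C T (Dom C i) \<and> i \<star> r = i \<star> s"
    using assms(1) T comp unfolding kernel_of_def by blast
  then show ?thesis using assms by metis
qed

lemma kernel_factor:
  assumes "kernel_of C i p" "t \<in> Hom C T (Dom C p)" "p \<star> t = Zero C T (Cod C p)"
  obtains s where "s \<in> Hom C T (Dom C i)" "i \<star> s = t"
  using assms Hom_Obj(1)[OF assms(2)] that unfolding kernel_of_def by blast

lemma cokernel_epi:
  assumes "cokernel_of C p i" "s \<in> Hom C (Cod C p) T" "t \<in> Hom C (Cod C p) T" "s \<star> p = t \<star> p"
  shows "s = t"
proof -
  have ip: "i \<in> Hom C (Dom C i) (Cod C i)" "p \<in> Hom C (Cod C i) (Cod C p)"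
    and 0: "p \<star> i = Zero C (Dom C i) (Cod C p)"
    using assms(1) by (auto simp: cokernel_of_def Hom_iff)
  have T: "T \<in> Obj C" using Hom_Obj assms(2) by blast
  have comp: "s \<star> p \<in> Hom C (Cod C i) T" using ip assms comp_in_hom by blast
  have "(s \<star> p) \<star> i = Zero C (Dom C i) T"
    using comp_assoc[OF ip assms(2)] 0 comp_Zero_right[OF assms(2)] Hom_Obj(1)[OF ip(1)] by simp
  then have "\<exists>!r. r \<in> Hom C (Cod C p) T \<and> r \<star> p = s \<star> p"
    using assms(1) T comp unfolding cokernel_of_def by blast
  then show ?thesis using assms by metis
qed

lemma cokernel_factor:
  assumes "cokernel_of C p i" "t \<in> Hom C (Cod C i) T" "t \<star> i = Zero C (Dom C i) T"
  obtains s where "s \<in> Hom C (Cod C p) T" "s \<star> p = t"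
  using assms Hom_Obj(2)[OF assms(2)] that unfolding cokernel_of_def by blast

lemma kernel_unique:
  assumes k: "kernel_of C k p" and i: "kernel_of C i p"
  obtains b where "b \<in> iso_arr C (Dom C k) (Dom C i)" "i \<star> b = k"
proof -
  have kH: "k \<in> Hom C (Dom C k) (Dom C p)" "p \<star> k = Zero C (Dom C k) (Cod C p)"
    and iH: "i \<in> Hom C (Dom C i) (Dom C p)" "p \<star> i = Zero C (Dom C i) (Cod C p)"
    using k i by (auto simp: kernel_of_def Hom_iff)
  obtain b where b: "b \<in> Hom C (Dom C k) (Dom C i)" "i \<star> b = k"
    using kernel_factor[OF i kH] by blast
  obtain c where c: "c \<in> Hom C (Dom C i) (Dom C k)" "k \<star> c = i"
    using kernel_factor[OF k iH] by blast
  have obj: "Dom C k \<in> Obj C" "Dom C i \<in> Obj C" using Hom_Obj kH iH by auto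
  have "k \<star> (c \<star> b) = k \<star> Id C (Dom C k)"
    using comp_assoc[OF b(1) c(1) kH(1)] b c comp_id_right[OF kH(1)] by simp
  then have "c \<star> b = Id C (Dom C k)"
    using kernel_mono[OF k] comp_in_hom[OF b(1) c(1)] id_in_hom obj by blast
  moreover have "i \<star> (b \<star> c) = i \<star> Id C (Dom C i)"
    using comp_assoc[OF c(1) b(1) iH(1)] b c comp_id_right[OF iH(1)] by simp
  then have "b \<star> c = Id C (Dom C i)"
    using kernel_mono[OF i] comp_in_hom[OF c(1) b(1)] id_in_hom obj by blast
  ultimately have "b \<in> iso_arr C (Dom C k) (Dom C i)" using b c iso_arrI by blast
  then show thesis using b that by blast
qed

end

context category
begin

text \<open>The axioms supply only some pullback with an admissible projection; this comparison
  isomorphism carries admissibility over to any other pullback of the same arrows.\<close>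

lemma pullback_unique:
  assumes P: "pullback C p f p' f'" and Q: "pullback C p f q g"
  obtains w where "w \<in> iso_arr C (Dom C q) (Dom C p')" "p' \<star> w = q" "f' \<star> w = g"
proof -
  have PH: "p' \<in> Hom C (Dom C p') (Dom C f)" "f' \<in> Hom C (Dom C p') (Dom C p)" "p \<star> f' = f \<star> p'"
    and QH: "q \<in> Hom C (Dom C q) (Dom C f)" "g \<in> Hom C (Dom C q) (Dom C p)" "p \<star> g = f \<star> q"
    using P Q by (auto simp: pullback_def Hom_iff)
  have obj: "Dom C p' \<in> Obj C" "Dom C q \<in> Obj C" using Hom_Obj PH QH by auto
  have P1: "\<exists>!w. w \<in> Hom C T (Dom C p') \<and> f' \<star> w = u \<and> p' \<star> w = v"
    if "T \<in> Obj C" "u \<in> Hom C T (Dom C p)" "v \<in> Hom C T (Dom C f)" "p \<star> u = f \<star> v" for T u v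
    using P that unfolding pullback_def by blast
  have Q1: "\<exists>!w. w \<in> Hom C T (Dom C q) \<and> g \<star> w = u \<and> q \<star> w = v"
    if "T \<in> Obj C" "u \<in> Hom C T (Dom C p)" "v \<in> Hom C T (Dom C f)" "p \<star> u = f \<star> v" for T u v
    using Q that unfolding pullback_def by blast
  obtain w where w: "w \<in> Hom C (Dom C q) (Dom C p')" "f' \<star> w = g" "p' \<star> w = q"
    using P1[OF obj(2) QH(2,1,3)] by blast
  obtain w' where w': "w' \<in> Hom C (Dom C p') (Dom C q)" "g \<star> w' = f'" "q \<star> w' = p'"
    using Q1[OF obj(1) PH(2,1,3)] by blast
  have "f' \<star> (w \<star> w') = f' \<and> p' \<star> (w \<star> w') = p'"
    using comp_assoc[OF w'(1) w(1) PH(1)] comp_assoc[OF w'(1) w(1) PH(2)] w w' by simp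
  then have "w \<star> w' = Id C (Dom C p')"
    using P1[OF obj(1) PH(2,1,3)] comp_in_hom[OF w'(1) w(1)] id_in_hom[OF obj(1)]
      comp_id_right[OF PH(1)] comp_id_right[OF PH(2)] by blast
  moreover have "g \<star> (w' \<star> w) = g \<and> q \<star> (w' \<star> w) = q"
    using comp_assoc[OF w(1) w'(1) QH(1)] comp_assoc[OF w(1) w'(1) QH(2)] w w' by simp
  then have "w' \<star> w = Id C (Dom C q)"
    using Q1[OF obj(2) QH(2,1,3)] comp_in_hom[OF w(1) w'(1)] id_in_hom[OF obj(2)]
      comp_id_right[OF QH(1)] comp_id_right[OF QH(2)] by blast
  ultimately have "w \<in> iso_arr C (Dom C q) (Dom C p')" using w w' iso_arrI by blast
  then show thesis using w that by blast
qed

end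


section \<open>Exact categories\<close>

context exact_category
begin

lemma Ses_Hom:
  assumes "(i, p) \<in> Ses C"
  shows "i \<in> Hom C (Dom C i) (Dom C p)" "p \<in> Hom C (Dom C p) (Cod C p)"
    "p \<star> i = Zero C (Dom C i) (Cod C p)"
  using ses_kernel_cokernel[OF assms] by (auto simp: kernel_of_def Hom_iff)

text \<open>Admissibility of \<open>p\<close> provides only some kernel \<open>k\<close> with
  \<open>(k, p) \<in> Ses C\<close>. Any other kernel differs from it by an isomorphism, under which
  \<open>Ses C\<close> is closed.\<close>

lemma kernel_Ses:
  assumes p: "admissible_epi C p" and i: "kernel_of C i p"
  shows "(i, p) \<in> Ses C"
proof -
  obtain k where k: "(k, p) \<in> Ses C" using p unfolding admissible_epi_def by blast
  then obtain b where b: "b \<in> iso_arr C (Dom C k) (Dom C i)" "i \<star> b = k"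
    using kernel_unique i ses_kernel_cokernel by blast
  have H: "i \<in> Hom C (Dom C i) (Dom C p)" "p \<in> Hom C (Dom C p) (Cod C p)"
    using i by (auto simp: kernel_of_def Hom_iff)
  show ?thesis
    by (rule ses_iso_closed[OF k H b(1) Id_iso Id_iso])
      (use H Ses_Hom[OF k] b Hom_Obj[OF H(2)] comp_id_left comp_id_right in auto)
qed

text \<open>A pulled back admissible epimorphism is admissible, and the lift \<open>i'\<close> of
  the kernel of \<open>p\<close> is a kernel of \<open>p'\<close>; \<open>kernel_Ses\<close>
  combines the two.\<close>

lemma pullback_Ses:
  assumes p: "(i, p) \<in> Ses C" and P: "pullback C p f p' f'"
    and i': "i' \<in> Hom C (Dom C i) (Dom C p')" "f' \<star> i' = i"
      "p' \<star> i' = Zero C (Dom C i) (Dom C f)"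
  shows "(i', p') \<in> Ses C"
proof (rule kernel_Ses)
  have PH: "p' \<in> Hom C (Dom C p') (Dom C f)" "f' \<in> Hom C (Dom C p') (Dom C p)" "p \<star> f' = f \<star> p'"
    and f: "f \<in> Hom C (Dom C f) (Cod C p)" and p2: "p \<in> Hom C (Dom C p) (Cod C p)"
    using P by (auto simp: pullback_def Hom_iff)
  have "admissible_epi C p" using p unfolding admissible_epi_def by blast
  then obtain q g where Q: "pullback C p f q g" "admissible_epi C q"
    using pullback_admissible_epi[of p f] f by (auto simp: Hom_iff)
  then obtain k where k: "(k, q) \<in> Ses C" unfolding admissible_epi_def by blast
  obtain w where w: "w \<in> iso_arr C (Dom C q) (Dom C p')" "p' \<star> w = q"
    using pullback_unique[OF P Q(1)] by blast
  have wH: "w \<in> Hom C (Dom C q) (Dom C p')" using w unfolding iso_arr_def by blast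
  have q: "Cod C q = Dom C f" using Q(1) by (simp add: pullback_def)
  have "(w \<star> k, p') \<in> Ses C"
  proof (rule ses_iso_closed[OF k comp_in_hom[OF _ wH] PH(1) Id_iso w(1)])
    show "k \<in> Hom C (Dom C k) (Dom C q)" "Dom C k \<in> Obj C"
      using Ses_Hom[OF k] Hom_Obj by auto
    show "Id C (Dom C f) \<in> iso_arr C (Cod C q) (Dom C f)"
      using Id_iso Hom_Obj[OF f] q by simp
    show "w \<star> k = (w \<star> k) \<star> Id C (Dom C k)"
      using comp_id_right[OF comp_in_hom[OF Ses_Hom(1)[OF k] wH]] by simp
    show "Id C (Dom C f) \<star> q = p' \<star> w"
      using comp_id_left[OF Ses_Hom(2)[OF k]] w q by simp
  qed
  then show "admissible_epi C p'" unfolding admissible_epi_def by blast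
  have ker: "kernel_of C i p" using p ses_kernel_cokernel by blast
  have *: "\<exists>!s. s \<in> Hom C T (Dom C i') \<and> i' \<star> s = t"
    if T: "T \<in> Obj C" and t: "t \<in> Hom C T (Dom C p')" "p' \<star> t = Zero C T (Cod C p')" for T t
  proof -
    have cod: "Cod C p' = Dom C f" and dom: "Dom C i' = Dom C i"
      using PH i' by (auto simp: Hom_iff)
    have f't: "f' \<star> t \<in> Hom C T (Dom C p)" using comp_in_hom[OF t(1) PH(2)] .
    have "p \<star> (f' \<star> t) = Zero C T (Cod C p)"
      using comp_assoc[OF t(1) PH(2) p2] comp_assoc[OF t(1) PH(1) f] PH(3) t(2) cod
        comp_Zero_right[OF f T] by simp
    with f't have ex: "\<exists>!s. s \<in> Hom C T (Dom C i) \<and> i \<star> s = f' \<star> t"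
      using ker T unfolding kernel_of_def by blast
    \<comment> \<open>Factoring \<open>t\<close> through \<open>i'\<close> is the same problem as
      factoring \<open>f' \<star> t\<close> through \<open>i\<close>: \<open>p'\<close> kills both
      \<open>i' \<star> s\<close> and \<open>t\<close>, so by the pullback property they agree once
      their composites with \<open>f'\<close> do.\<close>
    moreover have "i' \<star> s = t \<longleftrightarrow> i \<star> s = f' \<star> t" if s: "s \<in> Hom C T (Dom C i)" for s
    proof
      show "i \<star> s = f' \<star> t" if "i' \<star> s = t"
        using comp_assoc[OF s i'(1) PH(2)] i'(2) that by simp
      assume a: "i \<star> s = f' \<star> t"
      have p't: "p' \<star> t \<in> Hom C T (Dom C f)" using comp_in_hom[OF t(1) PH(1)] .
      have "p \<star> (f' \<star> t) = f \<star> (p' \<star> t)"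
        using comp_assoc[OF t(1) PH(2) p2] comp_assoc[OF t(1) PH(1) f] PH(3) by simp
      then have "\<exists>!w. w \<in> Hom C T (Dom C p') \<and> f' \<star> w = f' \<star> t \<and> p' \<star> w = p' \<star> t"
        using P T f't p't unfolding pullback_def by blast
      moreover have "i' \<star> s \<in> Hom C T (Dom C p')" using comp_in_hom[OF s i'(1)] .
      moreover have "f' \<star> (i' \<star> s) = f' \<star> t"
        using comp_assoc[OF s i'(1) PH(2)] i'(2) a by simp
      moreover have "p' \<star> (i' \<star> s) = p' \<star> t"
        using comp_assoc[OF s i'(1) PH(1)] i'(3) t(2) cod comp_Zero_left[OF s] Hom_Obj[OF f] by simp
      ultimately show "i' \<star> s = t" using t(1) by blast
    qed
    ultimately have "s \<in> Hom C T (Dom C i') \<and> i' \<star> s = t \<longleftrightarrow>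
        s \<in> Hom C T (Dom C i) \<and> i \<star> s = f' \<star> t" for s using dom by auto
    then show ?thesis using ex by simp
  qed
  have "i' \<in> Arr C" "p' \<in> Arr C" "Cod C i' = Dom C p'" "Dom C i' = Dom C i" "Cod C p' = Dom C f"
    using i' PH by (auto simp: Hom_iff)
  then show "kernel_of C i' p'"
    unfolding kernel_of_def using i'(3) * by simp
qed

section \<open>Short exact sequences with prescribed terms\<close>

lemma ses_between_iff:
  "(i, p) \<in> ses_between C A B X \<longleftrightarrow> (i, p) \<in> Ses C \<and> i \<in> Hom C B X \<and> p \<in> Hom C X A"
  by (simp add: ses_between_def)

lemma ses_between_iso:
  assumes "ses_between C A B X \<noteq> {}" "iso_arr C X Y \<noteq> {}"
  shows "ses_between C A B Y \<noteq> {}"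
proof -
  obtain i p where ip: "(i, p) \<in> Ses C" "i \<in> Hom C B X" "p \<in> Hom C X A"
    using assms(1) ses_between_iff by auto
  obtain x where "x \<in> iso_arr C X Y" using assms(2) by blast
  then obtain y where x: "x \<in> Hom C X Y" "y \<in> Hom C Y X" "y \<star> x = Id C X" "x \<in> iso_arr C X Y"
    by (metis iso_arrE)
  have xi: "x \<star> i \<in> Hom C B Y" and py: "p \<star> y \<in> Hom C Y A" using ip x comp_in_hom by auto
  have dc: "Dom C i = B" "Dom C p = X" "Cod C p = A" using ip by (auto simp: Hom_iff)
  have "(x \<star> i, p \<star> y) \<in> Ses C"
  proof (rule ses_iso_closed[OF ip(1) xi py])
    show "Id C B \<in> iso_arr C (Dom C i) B" "x \<in> iso_arr C (Dom C p) Y"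
      "Id C A \<in> iso_arr C (Cod C p) A"
      using dc x Id_iso Hom_Obj[OF xi] Hom_Obj[OF py] by auto
    show "x \<star> i = (x \<star> i) \<star> Id C B" using comp_id_right[OF xi] by simp
    show "Id C A \<star> p = (p \<star> y) \<star> x"
      using comp_assoc[OF x(1,2) ip(3)] x comp_id_left[OF ip(3)] comp_id_right[OF ip(3)] by simp
  qed
  then have "(x \<star> i, p \<star> y) \<in> ses_between C A B Y" using xi py ses_between_iff by blast
  then show ?thesis by blast
qed

text \<open>\<open>Ext1\<close> only asks for a sequence through some representative of the class;
  \<open>ses_between_iso\<close> moves it to the given one.\<close>

lemma Ext1_iff:
  assumes "X \<in> Obj C"
  shows "iso_class C X \<in> Ext1 C A B \<longleftrightarrow> ses_between C A B X \<noteq> {}"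
proof
  assume "iso_class C X \<in> Ext1 C A B"
  then obtain Y where "Y \<in> Obj C" "ses_between C A B Y \<noteq> {}" "iso_class C Y = iso_class C X"
    unfolding Ext1_def by force
  then show "ses_between C A B X \<noteq> {}" using iso_class_eq_iff[of Y X] assms ses_between_iso by blast
next
  assume "ses_between C A B X \<noteq> {}"
  then show "iso_class C X \<in> Ext1 C A B" unfolding Ext1_def using assms by blast
qed

lemma Ext1_rep_iff:
  "x \<in> Iso C \<Longrightarrow> x \<in> Ext1 C A B \<longleftrightarrow> ses_between C A B (rep x) \<noteq> {}"
  using Ext1_iff[OF rep_Iso(1)] rep_Iso(2) by simp

text \<open>The axioms complete an identity to a short exact sequence by an unspecified arrow. Its
  composite with the identity is zero, so it is zero itself; being also epic or monic, it has a zero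
  object at its far end, which may be replaced by \<open>Z\<close>.\<close>

lemma Id_zero_Ses:
  assumes X: "X \<in> Obj C" and Z: "zero_object C Z"
  shows "(Id C X, Zero C X Z) \<in> Ses C" "(Zero C Z X, Id C X) \<in> Ses C"
proof -
  have ZO: "Z \<in> Obj C" using Z zero_object_iff by blast
  note IX = comp_id_left[OF id_in_hom[OF X]]
  obtain q where q: "(Id C X, q) \<in> Ses C"
    using id_admissible_mono[OF X] unfolding admissible_mono_def by blast
  have dc: "Dom C (Id C X) = X" "Cod C (Id C X) = X" using id_in_hom[OF X] by (auto simp: Hom_iff)
  have qH: "q \<in> Hom C X (Cod C q)" using Ses_Hom[OF q] dc by (simp add: Hom_iff)
  have q0: "q = Zero C X (Cod C q)" using Ses_Hom(3)[OF q] comp_id_right[OF qH] dc by simp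
  have co: "cokernel_of C q (Id C X)" using ses_kernel_cokernel q by blast
  have Q: "Cod C q \<in> Obj C" using Hom_Obj[OF qH] by blast
  have "Id C (Cod C q) = Zero C (Cod C q) (Cod C q)"
    using comp_id_left[OF qH] comp_Zero_left[OF qH Q] q0
    by (intro cokernel_epi[OF co id_in_hom[OF Q] Zero_in_Hom[OF Q Q]]) simp
  then have Q0: "zero_object C (Cod C q)" using Q zero_object_iff by blast
  have dq: "Dom C q = X" using qH by (simp add: Hom_iff)
  show "(Id C X, Zero C X Z) \<in> Ses C"
  proof (rule ses_iso_closed[OF q id_in_hom[OF X] Zero_in_Hom[OF X ZO]])
    show "Id C X \<in> iso_arr C (Dom C (Id C X)) X" "Id C X \<in> iso_arr C (Dom C q) X"
      using Id_iso[OF X] dc dq by auto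
    show "Zero C (Cod C q) Z \<in> iso_arr C (Cod C q) Z" by (rule zero_object_iso[OF Q0 Z])
    show "Zero C (Cod C q) Z \<star> q = Zero C X Z \<star> Id C X"
      using comp_Zero_left[OF qH ZO] comp_id_right[OF Zero_in_Hom[OF X ZO]] by simp
  qed simp
  obtain k where k: "(k, Id C X) \<in> Ses C"
    using id_admissible_epi[OF X] unfolding admissible_epi_def by blast
  have kH: "k \<in> Hom C (Dom C k) X" using Ses_Hom[OF k] dc by simp
  have k0: "k = Zero C (Dom C k) X" using Ses_Hom(3)[OF k] comp_id_left[OF kH] dc by simp
  have ke: "kernel_of C k (Id C X)" using ses_kernel_cokernel k by blast
  have K: "Dom C k \<in> Obj C" using Hom_Obj[OF kH] by blast
  have "Id C (Dom C k) = Zero C (Dom C k) (Dom C k)"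
    using comp_id_right[OF kH] comp_Zero_right[OF kH K] k0
    by (intro kernel_mono[OF ke id_in_hom[OF K] Zero_in_Hom[OF K K]]) simp
  then have K0: "zero_object C (Dom C k)" using K zero_object_iff by blast
  show "(Zero C Z X, Id C X) \<in> Ses C"
  proof (rule ses_iso_closed[OF k Zero_in_Hom[OF ZO X] id_in_hom[OF X]])
    show "Id C X \<in> iso_arr C (Dom C (Id C X)) X" "Id C X \<in> iso_arr C (Cod C (Id C X)) X"
      using Id_iso[OF X] dc by auto
    show "Zero C (Dom C k) Z \<in> iso_arr C (Dom C k) Z" by (rule zero_object_iso[OF K0 Z])
    show "Id C X \<star> k = Zero C Z X \<star> Zero C (Dom C k) Z"
      using comp_id_left[OF kH] k0 comp_Zero_right[OF Zero_in_Hom[OF ZO X] K] by simp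
  qed simp
qed

text \<open>A kernel of a zero map is invertible, since the identity of \<open>X\<close> factors
  through it. Conversely an isomorphism transports the sequence of \<open>Id C A\<close>. The exact
  parametrisation allows the Hall numbers with a zero argument to be counted.\<close>

lemma ses_between_zero_left:
  assumes Z: "zero_object C Z"
  shows "ses_between C Z A X = (\<lambda>i. (i, Zero C X Z)) ` iso_arr C A X"
proof (intro equalityI subsetI)
  fix e assume "e \<in> ses_between C Z A X"
  then obtain i p where e: "e = (i, p)" "(i, p) \<in> Ses C" "i \<in> Hom C A X" "p \<in> Hom C X Z"
    using ses_between_iff by (cases e) auto
  have p: "p = Zero C X Z" using zero_object_Hom(2)[OF Z e(4)] .
  have ker: "kernel_of C i p" using e ses_kernel_cokernel by blast
  have X: "X \<in> Obj C" "A \<in> Obj C" using Hom_Obj e by auto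
  have dc: "Dom C i = A" "Dom C p = X" "Cod C p = Z" using e by (auto simp: Hom_iff)
  have "p \<star> Id C X = Zero C X Z" using comp_id_right[OF e(4)] p by simp
  then obtain s where s: "s \<in> Hom C X A" "i \<star> s = Id C X"
    using kernel_factor[OF ker, of "Id C X" X] id_in_hom[OF X(1)] dc by auto
  have "i \<star> (s \<star> i) = i \<star> Id C A"
    using comp_assoc[OF e(3) s(1) e(3)] s(2) comp_id_left[OF e(3)] comp_id_right[OF e(3)] by simp
  then have "s \<star> i = Id C A"
    using kernel_mono[OF ker, of "s \<star> i" A "Id C A"] comp_in_hom[OF e(3) s(1)]
      id_in_hom[OF X(2)] dc by simp
  then show "e \<in> (\<lambda>i. (i, Zero C X Z)) ` iso_arr C A X"
    using e p s iso_arrI by blast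
next
  fix e assume "e \<in> (\<lambda>i. (i, Zero C X Z)) ` iso_arr C A X"
  then obtain i where i: "i \<in> iso_arr C A X" "e = (i, Zero C X Z)" by blast
  then have iH: "i \<in> Hom C A X" unfolding iso_arr_def by blast
  have obj: "A \<in> Obj C" "X \<in> Obj C" "Z \<in> Obj C" using Hom_Obj[OF iH] Z zero_object_iff by auto
  note H = Zero_in_Hom[OF obj(2,3)] Zero_in_Hom[OF obj(1,3)] id_in_hom[OF obj(1)]
  have "(i, Zero C X Z) \<in> Ses C"
  proof (rule ses_iso_closed[OF Id_zero_Ses(1)[OF obj(1) Z] iH H(1)])
    show "Id C A \<in> iso_arr C (Dom C (Id C A)) A" "i \<in> iso_arr C (Dom C (Zero C A Z)) X"
      "Id C Z \<in> iso_arr C (Cod C (Zero C A Z)) Z"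
      using i H Id_iso obj by (auto simp: Hom_iff)
    show "Id C Z \<star> Zero C A Z = Zero C X Z \<star> i"
      using comp_id_left[OF H(2)] comp_Zero_left[OF iH obj(3)] by simp
  qed simp
  then show "e \<in> ses_between C Z A X" using i iH H ses_between_iff by simp
qed

text \<open>Dual to the previous case: the identity of \<open>X\<close> factors through a cokernel
  of a zero map. The transport now runs along the inverse \<open>s\<close>, since it starts at the
  sequence with middle term \<open>A\<close>.\<close>

lemma ses_between_zero_right:
  assumes Z: "zero_object C Z"
  shows "ses_between C A Z X = (\<lambda>p. (Zero C Z X, p)) ` iso_arr C X A"
proof (intro equalityI subsetI)
  fix e assume "e \<in> ses_between C A Z X"
  then obtain i p where e: "e = (i, p)" "(i, p) \<in> Ses C" "i \<in> Hom C Z X" "p \<in> Hom C X A"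
    using ses_between_iff by (cases e) auto
  have i: "i = Zero C Z X" using zero_object_Hom(1)[OF Z e(3)] .
  have cok: "cokernel_of C p i" using e ses_kernel_cokernel by blast
  have X: "X \<in> Obj C" "A \<in> Obj C" using Hom_Obj e by auto
  have dc: "Dom C i = Z" "Cod C i = X" "Cod C p = A" using e by (auto simp: Hom_iff)
  have "Id C X \<star> i = Zero C Z X" using comp_id_left[OF e(3)] i by simp
  then obtain s where s: "s \<in> Hom C A X" "s \<star> p = Id C X"
    using cokernel_factor[OF cok, of "Id C X" X] id_in_hom[OF X(1)] dc by auto
  have "(p \<star> s) \<star> p = Id C A \<star> p"
    using comp_assoc[OF e(4) s(1) e(4)] s(2) comp_id_left[OF e(4)] comp_id_right[OF e(4)] by simp
  then have "p \<star> s = Id C A"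
    using cokernel_epi[OF cok, of "p \<star> s" A "Id C A"] comp_in_hom[OF s(1) e(4)]
      id_in_hom[OF X(2)] dc by simp
  then show "e \<in> (\<lambda>p. (Zero C Z X, p)) ` iso_arr C X A"
    using e i s iso_arrI by blast
next
  fix e assume "e \<in> (\<lambda>p. (Zero C Z X, p)) ` iso_arr C X A"
  then obtain p where p: "p \<in> iso_arr C X A" "e = (Zero C Z X, p)" by blast
  then obtain s where s: "p \<in> Hom C X A" "s \<in> Hom C A X" "p \<star> s = Id C A" "s \<in> iso_arr C A X"
    by (metis iso_arrE)
  have obj: "A \<in> Obj C" "X \<in> Obj C" "Z \<in> Obj C" using Hom_Obj[OF s(1)] Z zero_object_iff by auto
  note H = Zero_in_Hom[OF obj(3,2)] Zero_in_Hom[OF obj(3,1)] id_in_hom[OF obj(1)]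
  have "(Zero C Z X, p) \<in> Ses C"
  proof (rule ses_iso_closed[OF Id_zero_Ses(2)[OF obj(1) Z] H(1) s(1)])
    show "Id C Z \<in> iso_arr C (Dom C (Zero C Z A)) Z" "s \<in> iso_arr C (Dom C (Id C A)) X"
      "Id C A \<in> iso_arr C (Cod C (Id C A)) A"
      using s H Id_iso obj by (auto simp: Hom_iff)
    show "s \<star> Zero C Z A = Zero C Z X \<star> Id C Z"
      using comp_id_right[OF H(1)] comp_Zero_right[OF s(2) obj(3)] by simp
    show "Id C A \<star> Id C A = p \<star> s" using s(3) comp_id_left[OF H(3)] by simp
  qed
  then show "e \<in> ses_between C A Z X" using p s H ses_between_iff by simp
qed

text \<open>Both \<open>i\<close> and \<open>p\<close> are zero; as \<open>i\<close> is monic and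
  \<open>p\<close> is epic, cancellation makes the identities of \<open>B\<close> and
  \<open>A\<close> zero.\<close>

lemma zero_ses_between:
  assumes Z: "zero_object C Z" and ne: "ses_between C A B Z \<noteq> {}"
  shows "zero_object C A" "zero_object C B"
proof -
  obtain i p where ip: "(i, p) \<in> Ses C" "i \<in> Hom C B Z" "p \<in> Hom C Z A"
    using ne ses_between_iff by auto
  have obj: "A \<in> Obj C" "B \<in> Obj C" "Z \<in> Obj C" using Hom_Obj ip by auto
  have dc: "Dom C i = B" "Cod C p = A" using ip by (auto simp: Hom_iff)
  have kc: "kernel_of C i p" "cokernel_of C p i" using ip ses_kernel_cokernel by auto
  have "i = Zero C B Z" "p = Zero C Z A" using zero_object_Hom[OF Z] ip by auto
  then have "Id C B = Zero C B B" "Id C A = Zero C A A"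
    using kernel_mono[OF kc(1), of "Id C B" B "Zero C B B"]
      cokernel_epi[OF kc(2), of "Id C A" A "Zero C A A"] dc obj
      comp_id_right[OF ip(2)] comp_id_left[OF ip(3)] comp_Zero_right[OF ip(2) obj(2)]
      comp_Zero_left[OF ip(3) obj(1)] id_in_hom Zero_in_Hom by auto
  then show "zero_object C A" "zero_object C B" using obj zero_object_iff by auto
qed

text \<open>The map \<open>X \<times> B \<rightarrow> A \<times> B\<close> induced by \<open>p\<close> is the pullback of \<open>p\<close> along the projection
  \<open>A \<times> B \<rightarrow> A\<close>.\<close>

lemma product_ses_between:
  assumes ne: "ses_between C A N X \<noteq> {}"
    and S: "product C S X B s1 s2" and T: "product C T A B t1 t2"
  shows "ses_between C T N S \<noteq> {}"
proof -
  obtain i p where ip: "(i, p) \<in> Ses C" "i \<in> Hom C N X" "p \<in> Hom C X A"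
    using ne ses_between_iff by auto
  have SH: "s1 \<in> Hom C S X" "s2 \<in> Hom C S B" and TH: "t1 \<in> Hom C T A" "t2 \<in> Hom C T B"
    using S T unfolding product_def by auto
  have obj: "A \<in> Obj C" "N \<in> Obj C" "X \<in> Obj C" "B \<in> Obj C" "S \<in> Obj C" "T \<in> Obj C"
    using Hom_Obj ip SH TH by auto
  have SU: "\<exists>!w. w \<in> Hom C Y S \<and> s1 \<star> w = u \<and> s2 \<star> w = v"
    if "Y \<in> Obj C" "u \<in> Hom C Y X" "v \<in> Hom C Y B" for Y u v
    using S that unfolding product_def by blast
  have TU: "\<exists>!w. w \<in> Hom C Y T \<and> t1 \<star> w = u \<and> t2 \<star> w = v"
    if "Y \<in> Obj C" "u \<in> Hom C Y A" "v \<in> Hom C Y B" for Y u v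
    using T that unfolding product_def by blast
  obtain q where q: "q \<in> Hom C S T" "t1 \<star> q = p \<star> s1" "t2 \<star> q = s2"
    using TU[OF obj(5) comp_in_hom[OF SH(1) ip(3)] SH(2)] by blast
  \<comment> \<open>\<open>j\<close> is the lift of \<open>i\<close> with second component zero, as
    \<open>pullback_Ses\<close> requires for the kernel of \<open>q\<close>.\<close>
  obtain j where j: "j \<in> Hom C N S" "s1 \<star> j = i" "s2 \<star> j = Zero C N B"
    using SU[OF obj(2) ip(2) Zero_in_Hom[OF obj(2,4)]] by blast
  have pi: "p \<star> i = Zero C N A" using Ses_Hom(3)[OF ip(1)] ip by (simp add: Hom_iff)
  have qj: "q \<star> j = Zero C N T"
  proof -
    have "t1 \<star> (q \<star> j) = Zero C N A"
      using comp_assoc[OF j(1) q(1) TH(1)] comp_assoc[OF j(1) SH(1) ip(3)] q j pi by simp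
    moreover have "t2 \<star> (q \<star> j) = Zero C N B"
      using comp_assoc[OF j(1) q(1) TH(2)] q j by simp
    ultimately show ?thesis
      using TU[OF obj(2) Zero_in_Hom[OF obj(2,1)] Zero_in_Hom[OF obj(2,4)]]
        comp_in_hom[OF j(1) q(1)] Zero_in_Hom[OF obj(2,6)]
        comp_Zero_right[OF TH(1) obj(2)] comp_Zero_right[OF TH(2) obj(2)] by blast
  qed
  have "pullback C p t1 q s1"
  proof -
    have *: "\<exists>!w. w \<in> Hom C Y S \<and> s1 \<star> w = u \<and> q \<star> w = v"
      if Y: "Y \<in> Obj C" and u: "u \<in> Hom C Y X" and v: "v \<in> Hom C Y T"
        and eq: "p \<star> u = t1 \<star> v" for Y u v
    proof -
      have t2v: "t2 \<star> v \<in> Hom C Y B" using comp_in_hom[OF v TH(2)] .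
      have t1v: "t1 \<star> v \<in> Hom C Y A" using comp_in_hom[OF v TH(1)] .
      \<comment> \<open>Once \<open>s1 \<star> w\<close> is fixed, the first component of
        \<open>q \<star> w\<close> is correct automatically, so the pullback property becomes the
        universal property of \<open>S\<close>.\<close>
      have "q \<star> w = v \<longleftrightarrow> s2 \<star> w = t2 \<star> v" if w: "w \<in> Hom C Y S" "s1 \<star> w = u" for w
      proof
        show "s2 \<star> w = t2 \<star> v" if "q \<star> w = v"
          using comp_assoc[OF w(1) q(1) TH(2)] q(3) that by simp
        assume "s2 \<star> w = t2 \<star> v"
        then have "t2 \<star> (q \<star> w) = t2 \<star> v"
          using comp_assoc[OF w(1) q(1) TH(2)] q(3) by simp
        moreover have "t1 \<star> (q \<star> w) = t1 \<star> v"
          using comp_assoc[OF w(1) q(1) TH(1)] comp_assoc[OF w(1) SH(1) ip(3)] q(2) w eq by simp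
        ultimately show "q \<star> w = v"
          using TU[OF Y t1v t2v] comp_in_hom[OF w(1) q(1)] v by blast
      qed
      then have "w \<in> Hom C Y S \<and> s1 \<star> w = u \<and> q \<star> w = v \<longleftrightarrow>
          w \<in> Hom C Y S \<and> s1 \<star> w = u \<and> s2 \<star> w = t2 \<star> v" for w by blast
      then show ?thesis using SU[OF Y u t2v] by simp
    qed
    have "p \<in> Arr C" "t1 \<in> Arr C" "q \<in> Arr C" "s1 \<in> Arr C" "Dom C p = X" "Cod C p = A"
      "Dom C t1 = T" "Cod C t1 = A" "Dom C q = S" "Cod C q = T" "Dom C s1 = S" "Cod C s1 = X"
      using ip SH TH q by (auto simp: Hom_iff)
    then show ?thesis unfolding pullback_def using q(2) * by simp
  qed
  then have "(j, q) \<in> Ses C"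
    by (rule pullback_Ses[OF ip(1)]) (use ip j qj q TH in \<open>auto simp: Hom_iff\<close>)
  then have "(j, q) \<in> ses_between C T N S" using j q ses_between_iff by blast
  then show ?thesis by blast
qed

text \<open>The split sequence is the product of the sequence
  \<open>B \<rightarrow> B \<rightarrow> Z\<close> with \<open>A\<close>, where \<open>A\<close>
  itself serves as the product of \<open>Z\<close> and \<open>A\<close>.\<close>

lemma ses_between_product:
  assumes S: "product C S A B s1 s2"
  shows "ses_between C A B S \<noteq> {}"
proof -
  obtain Z where Z: "zero_object C Z" using has_zero_object by blast
  have SH: "s1 \<in> Hom C S A" "s2 \<in> Hom C S B" using S unfolding product_def by auto
  have obj: "A \<in> Obj C" "B \<in> Obj C" "S \<in> Obj C" "Z \<in> Obj C"
    using Hom_Obj[OF SH(1)] Hom_Obj[OF SH(2)] Z zero_object_iff by auto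
  have "ses_between C Z B B \<noteq> {}"
    using ses_between_zero_left[OF Z] Id_iso[OF obj(2)] by auto
  moreover have "product C A Z A (Zero C A Z) (Id C A)"
    unfolding product_def
  proof (intro conjI ballI)
    show "Zero C A Z \<in> Hom C A Z" "Id C A \<in> Hom C A A"
      using obj Zero_in_Hom id_in_hom by auto
    fix T u v assume T: "u \<in> Hom C T Z" "v \<in> Hom C T A"
    have "Zero C A Z \<star> v = u"
      using comp_Zero_left[OF T(2) obj(4)] zero_object_Hom(2)[OF Z T(1)] by simp
    moreover have "Id C A \<star> w = v \<longleftrightarrow> w = v" if "w \<in> Hom C T A" for w
      using comp_id_left[OF that] by simp
    ultimately show "\<exists>!w. w \<in> Hom C T A \<and> Zero C A Z \<star> w = u \<and> Id C A \<star> w = v"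
      using T(2) by (intro ex1I[of _ v]) auto
  qed
  ultimately show ?thesis by (rule product_ses_between[OF _ product_commute[OF S]])
qed

section \<open>The Grothendieck congruence and its compatibility with direct sums\<close>

lemma Grothendieck_congI:
  assumes "x \<in> Ext1 C M N" "y \<in> Ext1 C M N"
  shows "(x, y) \<in> Grothendieck_cong C"
proof -
  have "M \<in> Obj C" "N \<in> Obj C"
proof -
    obtain X i p where "i \<in> Hom C N X" "p \<in> Hom C X M"
      using assms(1) unfolding Ext1_def ses_between_def by auto
    then show "M \<in> Obj C" "N \<in> Obj C" using Hom_Obj by auto
  qed
  then show ?thesis unfolding Grothendieck_cong_def using assms by blast
qed

lemma sym_Grothendieck_cong: "sym (Grothendieck_cong C)"
  unfolding Grothendieck_cong_def by (rule sym_trancl) (auto simp: sym_def)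

lemma trans_Grothendieck_cong: "trans (Grothendieck_cong C)"
  unfolding Grothendieck_cong_def by simp

lemma Grothendieck_class_eqI:
  assumes "(x, y) \<in> Grothendieck_cong C"
  shows "Grothendieck_class C x = Grothendieck_class C y"
proof -
  have "(x, z) \<in> Grothendieck_cong C \<longleftrightarrow> (y, z) \<in> Grothendieck_cong C" for z
    using transD[OF trans_Grothendieck_cong assms]
      transD[OF trans_Grothendieck_cong symD[OF sym_Grothendieck_cong assms]] by blast
  then show ?thesis unfolding Grothendieck_class_def by blast
qed

text \<open>The congruence is a transitive closure, so reflexivity has to come from a sequence:
  every object is the middle term of one with itself as first term and a zero object as
  last.\<close>

lemma Grothendieck_cong_refl:
  assumes "x \<in> Iso C"
  shows "(x, x) \<in> Grothendieck_cong C"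
proof -
  obtain Z where Z: "zero_object C Z" using has_zero_object by blast
  have "x \<in> Ext1 C Z (rep x)"
    using Ext1_rep_iff[OF assms] ses_between_zero_left[OF Z] Id_iso rep_Iso[OF assms] by blast
  then show ?thesis by (intro Grothendieck_congI)
qed

lemma Grothendieck_class_eq_iff:
  assumes "y \<in> Iso C"
  shows "Grothendieck_class C x = Grothendieck_class C y \<longleftrightarrow> (x, y) \<in> Grothendieck_cong C"
proof
  assume "Grothendieck_class C x = Grothendieck_class C y"
  then have "y \<in> Grothendieck_class C x"
    using Grothendieck_cong_refl[OF assms] by (simp add: Grothendieck_class_def)
  then show "(x, y) \<in> Grothendieck_cong C" by (simp add: Grothendieck_class_def)
qed (rule Grothendieck_class_eqI)

lemma Grothendieck_cong_induct [consumes 1, case_names base step]: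
  assumes "(x, y) \<in> Grothendieck_cong C"
    and "\<And>M N y. \<lbrakk>M \<in> Obj C; N \<in> Obj C; x \<in> Ext1 C M N; y \<in> Ext1 C M N\<rbrakk> \<Longrightarrow> P y"
    and "\<And>M N y z. \<lbrakk>P y; M \<in> Obj C; N \<in> Obj C; y \<in> Ext1 C M N; z \<in> Ext1 C M N\<rbrakk> \<Longrightarrow> P z"
  shows "P y"
  using assms(1) unfolding Grothendieck_cong_def
proof (induction rule: trancl_induct)
  case (base y)
  then obtain M N where "M \<in> Obj C" "N \<in> Obj C" "x \<in> Ext1 C M N" "y \<in> Ext1 C M N" by auto
  then show ?case by (rule assms(2))
next
  case (step y z)
  then obtain M N where "M \<in> Obj C" "N \<in> Obj C" "y \<in> Ext1 C M N" "z \<in> Ext1 C M N" by auto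
  with step.IH show ?case by (rule assms(3))
qed

lemma Ext1_Iso: "Ext1 C M N \<subseteq> Iso C"
  unfolding Ext1_def Iso_def by blast

text \<open>If \<open>X\<close> and \<open>Y\<close> are middle terms between \<open>N\<close> and
  \<open>M\<close>, then their products with \<open>B\<close> are middle terms between
  \<open>N\<close> and the product of \<open>M\<close> with \<open>B\<close>, by
  \<open>product_ses_between\<close>. Chains of such steps follow by induction.\<close>

lemma Grothendieck_cong_product:
  assumes "(x, y) \<in> Grothendieck_cong C"
    and "X \<in> Obj C" "iso_class C X = x" "product C S X B s1 s2"
    and "Y \<in> Obj C" "iso_class C Y = y" "product C T Y B t1 t2"
  shows "(iso_class C S, iso_class C T) \<in> Grothendieck_cong C"
proof -
  have B: "B \<in> Obj C" using assms(4) Hom_Obj unfolding product_def by blast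
  have ext: "(iso_class C S, iso_class C T) \<in> Grothendieck_cong C"
    if "M \<in> Obj C" "X \<in> Obj C" "Y \<in> Obj C" "iso_class C X \<in> Ext1 C M N" "iso_class C Y \<in> Ext1 C M N"
      "product C S X B s1 s2" "product C T Y B t1 t2" for M N X Y S T s1 s2 t1 t2
  proof -
    obtain R r1 r2 where R: "product C R M B r1 r2" using ex_product \<open>M \<in> Obj C\<close> B by blast
    have "S \<in> Obj C" "T \<in> Obj C" using that Hom_Obj unfolding product_def by blast+
    moreover have "ses_between C M N X \<noteq> {}" "ses_between C M N Y \<noteq> {}"
      using that Ext1_iff by blast+
    ultimately have "iso_class C S \<in> Ext1 C R N" "iso_class C T \<in> Ext1 C R N"
      using product_ses_between[OF _ _ R] that Ext1_iff by blast+
    then show ?thesis by (rule Grothendieck_congI)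
  qed
  \<comment> \<open>Intermediate classes carry neither a distinguished object nor a distinguished
    product with \<open>B\<close>, so the induction is over all choices.\<close>
  have "\<forall>Y T t1 t2. Y \<in> Obj C \<longrightarrow> iso_class C Y = y \<longrightarrow> product C T Y B t1 t2 \<longrightarrow>
      (iso_class C S, iso_class C T) \<in> Grothendieck_cong C"
    using assms(1)
  proof (induction rule: Grothendieck_cong_induct)
    case (base M N y)
    then show ?case using ext assms(2-4) by blast
  next
    case (step M N y z)
    have y: "y \<in> Iso C" using step Ext1_Iso by blast
    obtain U u1 u2 where U: "product C U (rep y) B u1 u2" using ex_product rep_Iso[OF y] B by blast
    have "(iso_class C S, iso_class C U) \<in> Grothendieck_cong C"
      using step.IH rep_Iso[OF y] U by blast
    moreover have "(iso_class C U, iso_class C T) \<in> Grothendieck_cong C"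
      if "Y \<in> Obj C" "iso_class C Y = z" "product C T Y B t1 t2" for Y T t1 t2
      using ext[of M "rep y" Y N U u1 u2 T t1 t2] step.hyps rep_Iso[OF y] U that by simp
    ultimately show ?case
      using transD[OF trans_Grothendieck_cong] by blast
  qed
  then show ?thesis using assms by blast
qed

end


section \<open>Orthogonal projection\<close>

text \<open>The index set is explicit so that it can be chosen finite; nonnegative weights then give
  a positive semidefinite form.\<close>

definition weighted_form :: "'i set \<Rightarrow> ('i \<Rightarrow> rat) \<Rightarrow> ('i \<Rightarrow>\<^sub>0 rat) \<Rightarrow> ('i \<Rightarrow>\<^sub>0 rat) \<Rightarrow> rat" where
  "weighted_form D w v u = (\<Sum>c\<in>D. w c * (Poly_Mapping.lookup v c * Poly_Mapping.lookup u c))"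

lemma weighted_form_diff_left:
  "weighted_form D w (v - v') u = weighted_form D w v u - weighted_form D w v' u"
  by (simp add: weighted_form_def lookup_minus algebra_simps sum_subtractf)

lemma weighted_form_scale_left:
  "weighted_form D w (scale r v) u = r * weighted_form D w v u"
  by (simp add: weighted_form_def sum_distrib_left algebra_simps)

lemma weighted_form_add_right:
  "weighted_form D w u (v + v') = weighted_form D w u v + weighted_form D w u v'"
  by (simp add: weighted_form_def lookup_add algebra_simps sum.distrib)

lemma weighted_form_scale_right:
  "weighted_form D w u (scale r v) = r * weighted_form D w u v"
  by (simp add: weighted_form_def sum_distrib_left algebra_simps)

lemma subspace_weighted_form: "hall.subspace {u. weighted_form D w v u = 0}"
  by (auto simp: hall.subspace_def weighted_form_add_right weighted_form_scale_right)
    (simp add: weighted_form_def)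

lemma weighted_form_orthogonal_span:
  assumes "u \<in> hall.span T" "\<And>t. t \<in> T \<Longrightarrow> weighted_form D w v t = 0"
  shows "weighted_form D w v u = 0"
  using hall.span_induct[OF assms(1) subspace_weighted_form[of D w v]] assms(2) by simp

text \<open>A vanishing sum of nonnegative terms has vanishing terms. As a weight may be zero, only
  the weighted coefficient is seen to vanish.\<close>

lemma weighted_form_self_eq_0:
  assumes "finite D" "\<And>c. c \<in> D \<Longrightarrow> 0 \<le> w c" "weighted_form D w v v = 0"
  shows "c \<in> D \<Longrightarrow> w c * Poly_Mapping.lookup v c = 0"
  using assms sum_nonneg_eq_0_iff[of D "\<lambda>c. w c * (Poly_Mapping.lookup v c * Poly_Mapping.lookup v c)"]
  by (force simp: weighted_form_def)

text \<open>Gram-Schmidt without normalisation, which stays inside the rationals, by induction on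
  the finite generating set.\<close>

lemma exists_orthogonal_projection:
  assumes "finite T" and D: "finite D" "\<And>c. c \<in> D \<Longrightarrow> 0 \<le> w c"
  shows "\<exists>p \<in> hall.span T. \<forall>t \<in> T. weighted_form D w (v - p) t = 0"
  using assms(1)
proof (induction T arbitrary: v)
  case empty
  then show ?case by (intro bexI[of _ 0]) (auto simp: hall.span_zero)
next
  case (insert t T)
  \<comment> \<open>The induction hypothesis is applied to the new generator as well as to
    \<open>v\<close>: \<open>t'\<close> is the part of \<open>t\<close> orthogonal to
    \<open>T\<close>, and subtracting its multiple \<open>r\<close> from \<open>q\<close> does not
    disturb orthogonality to \<open>T\<close>.\<close>
  obtain p0 where p0: "p0 \<in> hall.span T" "\<And>s. s \<in> T \<Longrightarrow> weighted_form D w (t - p0) s = 0"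
    using insert.IH[of t] by blast
  obtain p where p: "p \<in> hall.span T" "\<And>s. s \<in> T \<Longrightarrow> weighted_form D w (v - p) s = 0"
    using insert.IH[of v] by blast
  define t' where "t' = t - p0"
  define q where "q = v - p"
  define r where "r = weighted_form D w q t' / weighted_form D w t' t'"
  have sub: "hall.span T \<subseteq> hall.span (insert t T)" by (rule hall.span_mono) auto
  have "t' \<in> hall.span (insert t T)"
    using p0 sub hall.span_base[of t "insert t T"] unfolding t'_def by (auto intro: hall.span_diff)
  then have mem: "p + scale r t' \<in> hall.span (insert t T)"
    using p sub by (auto intro: hall.span_add hall.span_scale)
  have eq: "v - (p + scale r t') = q - scale r t'" by (simp add: q_def algebra_simps)
  have T: "weighted_form D w (q - scale r t') s = 0" if "s \<in> T" for s
    using p(2)[OF that] p0(2)[OF that]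
    by (simp add: q_def t'_def weighted_form_diff_left weighted_form_scale_left)
  \<comment> \<open>If \<open>t'\<close> is isotropic, its weighted coefficients vanish by
    semidefiniteness, so both sides are zero.\<close>
  have "weighted_form D w q t' = r * weighted_form D w t' t'"
  proof (cases "weighted_form D w t' t' = 0")
    case True
    have "w c * (Poly_Mapping.lookup q c * Poly_Mapping.lookup t' c) = 0" if "c \<in> D" for c
      using weighted_form_self_eq_0[OF D True that] by auto
    then have "weighted_form D w q t' = 0"
      unfolding weighted_form_def by (intro sum.neutral) blast
    then show ?thesis using True by simp
  qed (simp add: r_def)
  then have "weighted_form D w (q - scale r t') t' = 0"
    by (simp add: weighted_form_diff_left weighted_form_scale_left)
  moreover have "weighted_form D w (q - scale r t') p0 = 0"
    using weighted_form_orthogonal_span[OF p0(1) T] .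
  ultimately have "weighted_form D w (q - scale r t') t = 0"
    using weighted_form_add_right[of D w "q - scale r t'" t' p0] by (simp add: t'_def)
  with T mem show ?case unfolding eq[symmetric] by blast
qed


section \<open>The Hall algebra\<close>

lemma subspace_Hall_space: "hall.subspace (Hall_space C)"
proof -
  have "Hall_space C = {v. \<forall>x. x \<notin> Iso C \<longrightarrow> Poly_Mapping.lookup v x = 0}"
    unfolding Hall_space_def by (auto simp: in_keys_iff)
  then show ?thesis by (simp add: hall.subspace_def lookup_add)
qed

lemma single_decomposition:
  fixes v :: "'i \<Rightarrow>\<^sub>0 rat"
  shows "(\<Sum>a\<in>Poly_Mapping.keys v. scale (Poly_Mapping.lookup v a) (Poly_Mapping.single a 1)) = v"
  by (rule poly_mapping_eqI)
    (auto simp: lookup_sum lookup_single when_def in_keys_iff if_distrib sum.delta' cong: if_cong)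

text \<open>Reduces closure under products to basis elements; applied to the Hall space, to the
  augmentation ideal and to orthogonal complements.\<close>

lemma Hall_mult_in_subspace:
  assumes "hall.subspace K"
    and "\<And>a b. \<lbrakk>a \<in> Poly_Mapping.keys v; b \<in> Poly_Mapping.keys w\<rbrakk> \<Longrightarrow> Hall_mult_basis C a b \<in> K"
  shows "Hall_mult C v w \<in> K"
  unfolding Hall_mult_def using assms
  by (intro hall.subspace_sum hall.subspace_scale) auto

lemma lookup_tensor:
  "Poly_Mapping.lookup (tensor v w) (a, b) = Poly_Mapping.lookup v a * Poly_Mapping.lookup w b"
proof -
  have "Poly_Mapping.lookup (tensor v w) (a, b) =
      (\<Sum>a'\<in>Poly_Mapping.keys v. if a' = a then (\<Sum>b'\<in>Poly_Mapping.keys w.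
        if b' = b then Poly_Mapping.lookup v a * Poly_Mapping.lookup w b else 0) else 0)"
    unfolding tensor_def lookup_sum lookup_single
    by (intro sum.cong refl) (auto simp: when_def intro!: sum.cong)
  also have "\<dots> = Poly_Mapping.lookup v a * Poly_Mapping.lookup w b"
    by (auto simp: sum.delta in_keys_iff)
  finally show ?thesis .
qed

section \<open>The zero class and the degree\<close>

definition zero_class :: "('o, 'm, 'z) category_scheme \<Rightarrow> 'o set" where
  "zero_class C = iso_class C (SOME Z. zero_object C Z)"

definition End_size :: "('o, 'm, 'z) category_scheme \<Rightarrow> 'o set \<Rightarrow> nat" where
  "End_size C x = card (Hom C (rep x) (rep x))"

text \<open>The maximum runs over a whole Grothendieck class, so the degree is constant on it,
  whereas \<open>End_size\<close> may vary. For a profinitary category the maximum is over a finite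
  set.\<close>

definition degree :: "('o, 'm, 'z) exact_category_scheme \<Rightarrow> 'o set \<Rightarrow> nat" where
  "degree C x = Max (End_size C ` Iso_of_class C (Grothendieck_class C x))"

locale finitary_exact_category = exact_category C
  for C :: "('o, 'm, 'z) exact_category_scheme" (structure) +
  assumes profinitary: "profinitary C"
    and cofinitary: "cofinitary C"
begin

abbreviation Hall_coeff :: "'o set \<Rightarrow> 'o set \<Rightarrow> 'o set \<Rightarrow> rat" where
  "Hall_coeff a b c \<equiv> Hall_number C (rep a) (rep b) (rep c)"

abbreviation aut :: "'o set \<Rightarrow> rat" where
  "aut c \<equiv> of_nat (card (Aut C (rep c)))"

text \<open>\<open>D\<close> will be either the support of the left argument or a whole Grothendieck
  class.\<close>

abbreviation (input) Hall_form where
  "Hall_form D \<equiv> weighted_form D (\<lambda>c. 1 / aut c)"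

section \<open>Finiteness of the sums, and Hall numbers involving the zero class\<close>

lemma zero_class_Iso: "zero_class C \<in> Iso C"
proof -
  have "zero_object C (SOME Z. zero_object C Z)" using has_zero_object by (rule someI_ex)
  then show ?thesis unfolding Iso_def zero_class_def zero_object_def by blast
qed

lemma zero_object_rep_iff:
  assumes "x \<in> Iso C"
  shows "zero_object C (rep x) \<longleftrightarrow> x = zero_class C"
proof -
  have "zero_object C (SOME Z. zero_object C Z)" using has_zero_object by (rule someI_ex)
  then show ?thesis
    using iso_class_zero[OF _ rep_Iso(1)[OF assms]] rep_Iso(2)[OF assms] unfolding zero_class_def
    by simp
qed

lemma zero_object_rep: "zero_object C (rep (zero_class C))"
  using zero_object_rep_iff zero_class_Iso by blast

lemma finite_Hom: "finite (Hom C X Y)"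
proof (cases "Hom C X Y = {}")
  case False
  then obtain f where "f \<in> Hom C X Y" by blast
  then show ?thesis
    using Hom_Obj[of f X Y] profinitary unfolding profinitary_def hom_finite_def by blast
qed simp

lemma finite_iso_arr: "finite (iso_arr C X Y)"
  using finite_Hom finite_subset unfolding iso_arr_def by fastforce

lemma finite_ses_between: "finite (ses_between C A B X)"
  by (rule finite_subset[OF _ finite_cartesian_product[OF finite_Hom[of B X] finite_Hom[of X A]]])
    (auto simp: ses_between_def)

lemma aut_pos: "x \<in> Iso C \<Longrightarrow> 0 < aut x"
  using Id_iso[OF rep_Iso(1), of x] finite_iso_arr unfolding Aut_def
  by (auto simp: card_gt_0_iff)

lemma Hall_coeff_eq_0_iff:
  assumes "a \<in> Iso C" "b \<in> Iso C" "c \<in> Iso C"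
  shows "Hall_coeff a b c = 0 \<longleftrightarrow> c \<notin> Ext1 C (rep a) (rep b)"
  using aut_pos[OF assms(1)] aut_pos[OF assms(2)] finite_ses_between
  by (simp add: Hall_number_def Ext1_rep_iff[OF assms(3)])

lemma finite_Iso_of_class:
  assumes "x \<in> Iso C"
  shows "finite (Iso_of_class C (Grothendieck_class C x))"
  using profinitary quotientI[OF assms, of "Grothendieck_cong C"]
  unfolding profinitary_def Grothendieck_monoid_def Grothendieck_class_def by blast

lemma Ext1_Grothendieck_class:
  assumes "x \<in> Ext1 C M N" "y \<in> Ext1 C M N"
  shows "Grothendieck_class C x = Grothendieck_class C y"
  using Grothendieck_class_eqI[OF Grothendieck_congI[OF assms]] .

text \<open>All middle terms between two fixed ends lie in one Grothendieck class, which is finite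
  by profinitarity.\<close>

lemma finite_Ext1: "finite (Ext1 C M N)"
proof (cases "Ext1 C M N = {}")
  case False
  then obtain x where x: "x \<in> Ext1 C M N" by blast
  have "Ext1 C M N \<subseteq> Iso_of_class C (Grothendieck_class C x)"
    using Ext1_Grothendieck_class[OF _ x] Ext1_Iso unfolding Iso_of_class_def by blast
  then show ?thesis using finite_Iso_of_class x Ext1_Iso finite_subset by blast
qed simp

lemma finite_Ext1_pairs:
  assumes "x \<in> Iso C"
  shows "finite {(a, b) \<in> Iso C \<times> Iso C. x \<in> Ext1 C (rep a) (rep b)}"
proof -
  have "{(a, b) \<in> Iso C \<times> Iso C. x \<in> Ext1 C (rep a) (rep b)} \<subseteq>
    {(iso_class C A, iso_class C B) | A B. A \<in> Obj C \<and> B \<in> Obj C \<and> x \<in> Ext1 C A B}"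
    using rep_Iso by fastforce
  moreover have "finite {(iso_class C A, iso_class C B) | A B.
      A \<in> Obj C \<and> B \<in> Obj C \<and> x \<in> Ext1 C A B}"
    using cofinitary assms unfolding cofinitary_def by blast
  ultimately show ?thesis by (rule finite_subset)
qed

lemma aut_zero_class: "card (Aut C (rep (zero_class C))) = 1"
proof -
  let ?Z = "rep (zero_class C)"
  have "Aut C ?Z = {Zero C ?Z ?Z}"
    using zero_object_Hom(1)[OF zero_object_rep, of _ ?Z]
      zero_object_iso[OF zero_object_rep zero_object_rep]
    unfolding Aut_def by (auto simp: iso_arr_def)
  then show ?thesis by simp
qed

text \<open>The sequences correspond to isomorphisms between the representatives. Equal classes have
  the same representative, so the count cancels against \<open>aut a\<close>; distinct classes admit
  no isomorphism.\<close>

lemma Hall_coeff_zero_left: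
  assumes a: "a \<in> Iso C" and c: "c \<in> Iso C"
  shows "Hall_coeff (zero_class C) a c = (if a = c then 1 else 0)"
proof -
  let ?Z = "rep (zero_class C)"
  have Z: "ses_between C ?Z (rep a) (rep c) = (\<lambda>i. (i, Zero C (rep c) ?Z)) ` iso_arr C (rep a) (rep c)"
    by (rule ses_between_zero_left[OF zero_object_rep])
  have "card (ses_between C ?Z (rep a) (rep c)) = card (iso_arr C (rep a) (rep c))"
    unfolding Z by (rule card_image) (auto simp: inj_on_def)
  then have *: "Hall_coeff (zero_class C) a c = of_nat (card (iso_arr C (rep a) (rep c))) / aut a"
    by (simp add: Hall_number_def aut_zero_class)
  show ?thesis
  proof (cases "a = c")
    case True
    then show ?thesis using * aut_pos[OF a] by (simp add: Aut_def)
  next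
    case False
    then have "iso_arr C (rep a) (rep c) = {}"
      using iso_class_eq_iff[of "rep a" "rep c"] rep_Iso[OF a] rep_Iso[OF c] by simp
    then show ?thesis using * False by simp
  qed
qed

lemma Hall_coeff_zero_right:
  assumes a: "a \<in> Iso C" and c: "c \<in> Iso C"
  shows "Hall_coeff a (zero_class C) c = (if a = c then 1 else 0)"
proof -
  let ?Z = "rep (zero_class C)"
  have Z: "ses_between C (rep a) ?Z (rep c) = (\<lambda>p. (Zero C ?Z (rep c), p)) ` iso_arr C (rep c) (rep a)"
    by (rule ses_between_zero_right[OF zero_object_rep])
  have "card (ses_between C (rep a) ?Z (rep c)) = card (iso_arr C (rep c) (rep a))"
    unfolding Z by (rule card_image) (auto simp: inj_on_def)
  then have *: "Hall_coeff a (zero_class C) c = of_nat (card (iso_arr C (rep c) (rep a))) / aut a"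
    by (simp add: Hall_number_def aut_zero_class)
  show ?thesis
  proof (cases "a = c")
    case True
    then show ?thesis using * aut_pos[OF a] by (simp add: Aut_def)
  next
    case False
    then have "iso_arr C (rep c) (rep a) = {}"
      using iso_class_eq_iff[of "rep c" "rep a"] rep_Iso[OF a] rep_Iso[OF c] by simp
    then show ?thesis using * False by simp
  qed
qed

lemma Ext1_zero_class:
  assumes "a \<in> Iso C" "b \<in> Iso C" "zero_class C \<in> Ext1 C (rep a) (rep b)"
  shows "a = zero_class C" "b = zero_class C"
  using zero_ses_between[OF zero_object_rep] assms(3) zero_object_rep_iff[OF assms(1)]
    zero_object_rep_iff[OF assms(2)] Ext1_rep_iff[OF zero_class_Iso] by blast+

text \<open>Along a chain of the congruence, a zero middle term forces zero ends, and then every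
  other middle term with these ends is isomorphic to one of them.\<close>

lemma Grothendieck_class_zero:
  assumes "x \<in> Iso C" "Grothendieck_class C x = Grothendieck_class C (zero_class C)"
  shows "x = zero_class C"
proof -
  have ext: "y = zero_class C" if "zero_class C \<in> Ext1 C M N" "y \<in> Ext1 C M N" for M N y
  proof -
    have y: "y \<in> Iso C" using that Ext1_Iso by blast
    have MN: "zero_object C M" "zero_object C N"
      using zero_ses_between[OF zero_object_rep] that Ext1_rep_iff[OF zero_class_Iso] by auto
    have "ses_between C M N (rep y) \<noteq> {}" using that y Ext1_rep_iff by blast
    then obtain i where "i \<in> iso_arr C N (rep y)"
      unfolding ses_between_zero_left[OF MN(1)] by blast
    then show ?thesis using iso_zero_object[OF MN(2)] zero_object_rep_iff[OF y] by blast
  qed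
  have "(zero_class C, x) \<in> Grothendieck_cong C"
    using assms Grothendieck_class_eq_iff[of x "zero_class C"] by simp
  then show ?thesis by (induction rule: Grothendieck_cong_induct) (use ext in auto)
qed

lemma degree_less_product:
  assumes x: "x \<in> Iso C" and a: "a \<in> Iso C" and b: "b \<in> Iso C" "b \<noteq> zero_class C"
    and S: "product C S (rep a) (rep b) s1 s2"
    and eq: "Grothendieck_class C (iso_class C S) = Grothendieck_class C x"
  shows "degree C a < degree C x"
proof -
  have "degree C a \<in> End_size C ` Iso_of_class C (Grothendieck_class C a)"
    unfolding degree_def using finite_Iso_of_class[OF a] a
    by (intro Max_in) (auto simp: Iso_of_class_def)
  then obtain a' where a': "a' \<in> Iso C" "Grothendieck_class C a = Grothendieck_class C a'"
    "degree C a = End_size C a'" unfolding Iso_of_class_def by auto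
  obtain T t1 t2 where T: "product C T (rep a') (rep b) t1 t2"
    using ex_product rep_Iso(1)[OF a'(1)] rep_Iso(1)[OF b(1)] by blast
  then have "t1 \<in> Hom C T (rep a')" unfolding product_def by blast
  then have TO: "T \<in> Obj C" using Hom_Obj by blast
  then have TI: "iso_class C T \<in> Iso C" unfolding Iso_def by blast
  have "(a, a') \<in> Grothendieck_cong C" using a' Grothendieck_class_eq_iff by blast
  \<comment> \<open>Passing from \<open>a\<close> to the maximiser \<open>a'\<close> keeps the
    product with \<open>b\<close> in the class of \<open>x\<close>, so \<open>T\<close> competes in
    the maximum for \<open>x\<close>.\<close>
  then have "(iso_class C S, iso_class C T) \<in> Grothendieck_cong C"
    by (rule Grothendieck_cong_product[OF _ rep_Iso[OF a] S rep_Iso[OF a'(1)] T])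
  then have T': "iso_class C T \<in> Iso_of_class C (Grothendieck_class C x)"
    using Grothendieck_class_eqI eq TI unfolding Iso_of_class_def by auto
  have "degree C a < card (Hom C T T)"
    using product_card_End[OF T finite_Hom] zero_object_rep_iff[OF b(1)] b(2) a'(3)
    by (simp add: End_size_def)
  also have "\<dots> \<le> End_size C (iso_class C T)"
  proof -
    obtain f where "f \<in> iso_arr C T (rep (iso_class C T))"
      using iso_class_eq_iff[OF TO rep_Iso(1)[OF TI]] rep_Iso(2)[OF TI] by auto
    then obtain g where "f \<in> Hom C T (rep (iso_class C T))" "g \<in> Hom C (rep (iso_class C T)) T"
      "g \<star> f = Id C T" by (rule iso_arrE)
    then show ?thesis unfolding End_size_def by (rule retract_card_End_le[OF finite_Hom])
  qed
  also have "\<dots> \<le> degree C x"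
    unfolding degree_def using T' finite_Iso_of_class[OF x] by (intro Max_ge) auto
  finally show ?thesis .
qed

text \<open>An arbitrary extension has the same Grothendieck class as the split one with the same
  ends, to which \<open>degree_less_product\<close> applies from either side.\<close>

lemma degree_less:
  assumes x: "x \<in> Ext1 C (rep a) (rep b)" and a: "a \<in> Iso C" "a \<noteq> zero_class C"
    and b: "b \<in> Iso C" "b \<noteq> zero_class C"
  shows "degree C a < degree C x" "degree C b < degree C x"
proof -
  obtain S s1 s2 where S: "product C S (rep a) (rep b) s1 s2"
    using ex_product rep_Iso(1)[OF a(1)] rep_Iso(1)[OF b(1)] by blast
  then have "s1 \<in> Hom C S (rep a)" unfolding product_def by blast
  then have "S \<in> Obj C" using Hom_Obj by blast
  then have "iso_class C S \<in> Ext1 C (rep a) (rep b)"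
    using ses_between_product[OF S] Ext1_iff by blast
  then have eq: "Grothendieck_class C (iso_class C S) = Grothendieck_class C x"
    using x Ext1_Grothendieck_class by blast
  have xI: "x \<in> Iso C" using x Ext1_Iso by blast
  show "degree C a < degree C x" by (rule degree_less_product[OF xI a(1) b S eq])
  show "degree C b < degree C x"
    by (rule degree_less_product[OF xI b(1) a product_commute[OF S] eq])
qed

section \<open>Product and coproduct in coordinates, and the description of primitive
  elements\<close>

lemma lookup_Hall_mult_basis:
  assumes "a \<in> Iso C" "b \<in> Iso C"
  shows "Poly_Mapping.lookup (Hall_mult_basis C a b) c = (if c \<in> Iso C then Hall_coeff a b c else 0)"
proof -
  have "{c \<in> Iso C. Hall_coeff a b c \<noteq> 0} \<subseteq> Ext1 C (rep a) (rep b)"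
    using Hall_coeff_eq_0_iff[OF assms] by blast
  then have fin: "finite {c \<in> Iso C. Hall_coeff a b c \<noteq> 0}" using finite_Ext1 finite_subset by blast
  have "Poly_Mapping.lookup (Hall_mult_basis C a b) c =
      (\<Sum>c'\<in>{c \<in> Iso C. Hall_coeff a b c \<noteq> 0}. if c' = c then Hall_coeff a b c else 0)"
    unfolding Hall_mult_basis_def lookup_sum lookup_single
    by (intro sum.cong refl) (auto simp: when_def)
  also have "\<dots> = (if c \<in> Iso C then Hall_coeff a b c else 0)"
    using fin by (auto simp: sum.delta)
  finally show ?thesis .
qed

lemma Hall_mult_basis_Hall_space:
  "\<lbrakk>a \<in> Iso C; b \<in> Iso C\<rbrakk> \<Longrightarrow> Hall_mult_basis C a b \<in> Hall_space C"
  unfolding Hall_space_def by (auto simp: in_keys_iff lookup_Hall_mult_basis split: if_splits)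

lemma lookup_Hall_comult_basis:
  assumes "c \<in> Iso C"
  shows "Poly_Mapping.lookup (Hall_comult_basis C c) (a, b) =
    (if a \<in> Iso C \<and> b \<in> Iso C then aut a * aut b / aut c * Hall_coeff b a c else 0)"
proof -
  let ?d = "\<lambda>a b. dual_Hall_number C (rep a) (rep b) (rep c)"
  let ?P = "{(a, b) \<in> Iso C \<times> Iso C. ?d a b \<noteq> 0}"
  have "?P \<subseteq> prod.swap ` {(a, b) \<in> Iso C \<times> Iso C. c \<in> Ext1 C (rep a) (rep b)}"
    using Hall_coeff_eq_0_iff assms by (auto simp: dual_Hall_number_def)
  then have fin: "finite ?P" using finite_Ext1_pairs[OF assms] finite_surj by blast
  have "Poly_Mapping.lookup (Hall_comult_basis C c) (a, b) =
      (\<Sum>ab\<in>?P. if ab = (a, b) then ?d a b else 0)"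
    unfolding Hall_comult_basis_def lookup_sum
    by (intro sum.cong refl) (auto simp: lookup_single when_def split: if_splits)
  also have "\<dots> = (if a \<in> Iso C \<and> b \<in> Iso C then ?d a b else 0)"
    using fin by (auto simp: sum.delta)
  finally show ?thesis by (simp add: dual_Hall_number_def)
qed

text \<open>This is the adjointness: \<open>1 / (aut a * aut b)\<close> is the square of the basis
  tensor of \<open>a\<close> and \<open>b\<close>, and the exchange of arguments in
  \<open>dual_Hall_number\<close> produces the opposite product.\<close>

lemma lookup_Hall_comult:
  assumes "v \<in> Hall_space C"
  shows "Poly_Mapping.lookup (Hall_comult C v) (a, b) =
    (if a \<in> Iso C \<and> b \<in> Iso C
     then aut a * aut b * Hall_form (Poly_Mapping.keys v) v (Hall_mult_basis C b a) else 0)"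
proof -
  have K: "c \<in> Iso C" if "c \<in> Poly_Mapping.keys v" for c using assms that unfolding Hall_space_def by blast
  show ?thesis
    unfolding Hall_comult_def weighted_form_def lookup_sum lookup_scale
    by (auto simp: lookup_Hall_comult_basis K lookup_Hall_mult_basis sum_distrib_left intro!: sum.cong)
qed

lemma Hall_mult_basis_zero_right:
  "a \<in> Iso C \<Longrightarrow> Hall_mult_basis C a (zero_class C) = Poly_Mapping.single a 1"
  by (rule poly_mapping_eqI)
    (auto simp: lookup_Hall_mult_basis zero_class_Iso Hall_coeff_zero_right lookup_single when_def)

lemma Hall_mult_basis_zero_left:
  "a \<in> Iso C \<Longrightarrow> Hall_mult_basis C (zero_class C) a = Poly_Mapping.single a 1"
  by (rule poly_mapping_eqI)
    (auto simp: lookup_Hall_mult_basis zero_class_Iso Hall_coeff_zero_left lookup_single when_def)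

lemma Hall_one_eq: "Hall_one C = Poly_Mapping.single (zero_class C) 1"
  by (simp add: Hall_one_def zero_class_def)

lemma Hall_mult_one_right:
  assumes "v \<in> Hall_space C"
  shows "Hall_mult C v (Hall_one C) = v"
proof -
  have "Hall_mult C v (Hall_one C) =
      (\<Sum>a\<in>Poly_Mapping.keys v. scale (Poly_Mapping.lookup v a) (Poly_Mapping.single a 1))"
    using assms unfolding Hall_mult_def Hall_one_eq
    by (intro sum.cong refl) (auto simp: Hall_space_def Hall_mult_basis_zero_right)
  then show ?thesis by (simp add: single_decomposition)
qed

lemma Hall_form_single:
  assumes "a \<in> Iso C"
  shows "aut a * Hall_form (Poly_Mapping.keys v) v (Poly_Mapping.single a 1) = Poly_Mapping.lookup v a"
proof -
  have "Hall_form (Poly_Mapping.keys v) v (Poly_Mapping.single a 1) =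
      (\<Sum>c\<in>Poly_Mapping.keys v. if c = a then Poly_Mapping.lookup v a / aut a else 0)"
    unfolding weighted_form_def by (intro sum.cong refl) (auto simp: lookup_single when_def)
  also have "\<dots> = Poly_Mapping.lookup v a / aut a" by (auto simp: sum.delta in_keys_iff)
  finally show ?thesis using aut_pos[OF assms] by simp
qed

text \<open>Coefficients are compared pair by pair. If a class of the pair is zero, the coproduct
  has the coefficient of \<open>v\<close> at the other one; if both are non-zero, the right-hand
  side of the primitivity equation vanishes and adjointness yields orthogonality.\<close>

lemma Hall_primitives_iff:
  assumes v: "v \<in> Hall_space C"
  shows "v \<in> Hall_primitives C \<longleftrightarrow> Poly_Mapping.lookup v (zero_class C) = 0 \<and>
    (\<forall>a \<in> Iso C - {zero_class C}. \<forall>b \<in> Iso C - {zero_class C}.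
       Hall_form (Poly_Mapping.keys v) v (Hall_mult_basis C a b) = 0)"
    (is "_ \<longleftrightarrow> ?R")
proof -
  let ?z = "zero_class C"
  have out: "Poly_Mapping.lookup v a = 0" if "a \<notin> Iso C" for a
    using v that unfolding Hall_space_def by (auto simp: in_keys_iff)
  let ?L = "Poly_Mapping.lookup (Hall_comult C v)"
  let ?r = "\<lambda>a b. Poly_Mapping.lookup v a * (if b = ?z then 1 else 0) +
    (if a = ?z then 1 else 0) * Poly_Mapping.lookup v b"
  have r: "Poly_Mapping.lookup (tensor v (Hall_one C) + tensor (Hall_one C) v) (a, b) = ?r a b" for a b
    by (auto simp: lookup_add lookup_tensor Hall_one_eq lookup_single when_def)
  have L1: "?L (a, ?z) = Poly_Mapping.lookup v a" if "a \<in> Iso C" for a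
    using lookup_Hall_comult[OF v, of a ?z] that
    by (simp add: zero_class_Iso Hall_mult_basis_zero_left Hall_form_single aut_zero_class)
  have L2: "?L (?z, b) = Poly_Mapping.lookup v b" if "b \<in> Iso C" for b
    using lookup_Hall_comult[OF v, of ?z b] that
    by (simp add: zero_class_Iso Hall_mult_basis_zero_right Hall_form_single aut_zero_class)
  have iff: "v \<in> Hall_primitives C \<longleftrightarrow> (\<forall>a b. ?L (a, b) = ?r a b)"
    using v r unfolding Hall_primitives_def by (auto simp: poly_mapping_eq_iff fun_eq_iff)
  show ?thesis
  proof
    assume "v \<in> Hall_primitives C"
    then have eq: "?L (a, b) = ?r a b" for a b using iff by blast
    \<comment> \<open>At the pair of zero classes one side is this coefficient and the other is
      twice it.\<close>
    have "Poly_Mapping.lookup v ?z = 0" using eq[of ?z ?z] L1[OF zero_class_Iso] by simp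
    moreover have "Hall_form (Poly_Mapping.keys v) v (Hall_mult_basis C a b) = 0"
      if "a \<in> Iso C - {?z}" "b \<in> Iso C - {?z}" for a b
      using eq[of b a] lookup_Hall_comult[OF v, of b a] aut_pos[of a] aut_pos[of b] that by simp
    ultimately show ?R by blast
  next
    assume R: ?R
    have "?L (a, b) = ?r a b" for a b
    proof (cases "a \<in> Iso C \<and> b \<in> Iso C")
      case False
      then show ?thesis using lookup_Hall_comult[OF v, of a b] out zero_class_Iso by auto
    next
      case True
      consider "b = ?z" | "a = ?z" | "a \<noteq> ?z" "b \<noteq> ?z" by blast
      then show ?thesis
      proof cases
        case 1 then show ?thesis using L1 True R by simp
      next
        case 2 then show ?thesis using L2 True R by simp
      next
        case 3 then show ?thesis using lookup_Hall_comult[OF v, of a b] True R by simp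
      qed
    qed
    then show "v \<in> Hall_primitives C" using iff by blast
  qed
qed

section \<open>Generation by primitive elements\<close>

lemma Hall_subalgebra_Hall_space: "Hall_subalgebra C (Hall_space C)"
  unfolding Hall_subalgebra_def
proof (intro conjI ballI)
  show "Hall_one C \<in> Hall_space C" unfolding Hall_one_eq Hall_space_def using zero_class_Iso by simp
  show "Hall_mult C v w \<in> Hall_space C" if "v \<in> Hall_space C" "w \<in> Hall_space C" for v w
    using that
    by (intro Hall_mult_in_subspace[OF subspace_Hall_space] Hall_mult_basis_Hall_space)
      (auto simp: Hall_space_def)
qed (simp_all add: subspace_Hall_space)

text \<open>The basis element of \<open>x\<close> splits as \<open>p + q\<close>, with
  \<open>p\<close> its projection onto the products of two non-zero classes in its graded piece.
  Factors of such products have smaller degree, which handles \<open>p\<close>, and \<open>q\<close>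
  is primitive.\<close>

lemma single_in_Hall_subalgebra:
  assumes S: "Hall_subalgebra C S" and V: "Hall_primitives C \<subseteq> S"
  shows "x \<in> Iso C \<Longrightarrow> Poly_Mapping.single x 1 \<in> S"
proof (induction x rule: measure_induct_rule[of "degree C"])
  case (less x)
  have sub: "hall.subspace S" and mult: "\<And>v w. \<lbrakk>v \<in> S; w \<in> S\<rbrakk> \<Longrightarrow> Hall_mult C v w \<in> S"
    using S unfolding Hall_subalgebra_def by auto
  let ?z = "zero_class C"
  show ?case
  proof (cases "x = ?z")
    case True
    then show ?thesis using S unfolding Hall_subalgebra_def Hall_one_eq by blast
  next
    case False
    define D where "D = Iso_of_class C (Grothendieck_class C x)"
    have D: "finite D" unfolding D_def by (rule finite_Iso_of_class[OF less.prems])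
    have DI: "D \<subseteq> Iso C" unfolding D_def Iso_of_class_def by blast
    have xD: "x \<in> D" using less.prems by (simp add: D_def Iso_of_class_def)
    have zD: "?z \<notin> D"
      using Grothendieck_class_zero[OF less.prems] False by (auto simp: D_def Iso_of_class_def)
    \<comment> \<open>Pairs of non-zero classes with some extension in \<open>D\<close>: finitely
      many by cofinitarity, and all of their extensions then lie in \<open>D\<close>.\<close>
    define Q where "Q = (\<Union>y\<in>D. {(a, b) \<in> Iso C \<times> Iso C. y \<in> Ext1 C (rep a) (rep b)}) \<inter>
      {(a, b). a \<noteq> ?z \<and> b \<noteq> ?z}"
    define T where "T = (\<lambda>(a, b). Hall_mult_basis C a b) ` Q"
    have "finite Q" unfolding Q_def using D DI finite_Ext1_pairs by auto
    then have "finite T" unfolding T_def by simp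
    then obtain p where p: "p \<in> hall.span T"
      "\<And>t. t \<in> T \<Longrightarrow> Hall_form D (Poly_Mapping.single x 1 - p) t = 0"
      using exists_orthogonal_projection[OF _ D, of T "\<lambda>c. 1 / aut c" "Poly_Mapping.single x 1"] by auto
    define q where "q = Poly_Mapping.single x 1 - p"
    have Qprop: "a \<in> Iso C" "b \<in> Iso C" "a \<noteq> ?z" "b \<noteq> ?z" "Ext1 C (rep a) (rep b) \<subseteq> D"
      "degree C a < degree C x" "degree C b < degree C x" if ab: "(a, b) \<in> Q" for a b
    proof -
      obtain y where y: "y \<in> D" "y \<in> Ext1 C (rep a) (rep b)"
        and ab': "a \<in> Iso C" "b \<in> Iso C" "a \<noteq> ?z" "b \<noteq> ?z"
        using ab unfolding Q_def by auto
      have cl: "Grothendieck_class C y = Grothendieck_class C x"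
        using y(1) by (simp add: D_def Iso_of_class_def)
      show "a \<in> Iso C" "b \<in> Iso C" "a \<noteq> ?z" "b \<noteq> ?z" by fact+
      have "u \<in> D" if "u \<in> Ext1 C (rep a) (rep b)" for u
        using Ext1_Grothendieck_class[OF that y(2)] cl that Ext1_Iso[of "rep a" "rep b"]
        by (auto simp: D_def Iso_of_class_def)
      then show "Ext1 C (rep a) (rep b) \<subseteq> D" by blast
      have "degree C y = degree C x" using cl by (simp add: degree_def)
      then show "degree C a < degree C x" "degree C b < degree C x"
        using degree_less[OF y(2)] ab' by auto
    qed
    have "T \<subseteq> S"
    proof
      fix t assume "t \<in> T"
      then obtain a b where ab: "(a, b) \<in> Q" "t = Hall_mult_basis C a b" unfolding T_def by auto
      have "Hall_mult C (Poly_Mapping.single a 1) (Poly_Mapping.single b 1) \<in> S"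
        using mult less.IH Qprop[OF ab(1)] by blast
      then show "t \<in> S" using ab by (simp add: Hall_mult_def)
    qed
    then have pS: "p \<in> S" using p(1) hall.span_minimal sub by blast
    \<comment> \<open>The projection stays in the graded piece, so that the form over
      \<open>D\<close> agrees with the form over the support of \<open>q\<close>.\<close>
    have "hall.subspace {v. \<forall>c. c \<notin> D \<longrightarrow> Poly_Mapping.lookup v c = 0}"
      by (simp add: hall.subspace_def lookup_add)
    moreover have "T \<subseteq> {v. \<forall>c. c \<notin> D \<longrightarrow> Poly_Mapping.lookup v c = 0}"
      unfolding T_def using Qprop(1,2) subsetD[OF Qprop(5)] Hall_coeff_eq_0_iff
      by (auto simp: lookup_Hall_mult_basis)
    ultimately have "p \<in> {v. \<forall>c. c \<notin> D \<longrightarrow> Poly_Mapping.lookup v c = 0}"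
      using p(1) hall.span_minimal by blast
    then have q0: "Poly_Mapping.lookup q c = 0" if "c \<notin> D" for c
      using that xD by (auto simp: q_def lookup_minus lookup_single when_def)
    then have keys: "Poly_Mapping.keys q \<subseteq> D" by (auto simp: in_keys_iff)
    then have qH: "q \<in> Hall_space C" using DI unfolding Hall_space_def by blast
    have "q \<in> Hall_primitives C"
      unfolding Hall_primitives_iff[OF qH]
    proof (intro conjI ballI)
      show "Poly_Mapping.lookup q ?z = 0" using q0 zD by blast
      fix a b assume a: "a \<in> Iso C - {?z}" and b: "b \<in> Iso C - {?z}"
      have "Hall_form (Poly_Mapping.keys q) q (Hall_mult_basis C a b) =
          Hall_form D q (Hall_mult_basis C a b)"
        unfolding weighted_form_def using D keys
        by (intro sum.mono_neutral_left) (auto simp: in_keys_iff)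
      also have "\<dots> = 0"
      proof (cases "(a, b) \<in> Q")
        case True
        then show ?thesis using p(2) unfolding T_def q_def by force
      next
        case False
        \<comment> \<open>A pair outside \<open>Q\<close> has no extension in \<open>D\<close>, so
          its product lives in other graded pieces.\<close>
        then have "Hall_coeff a b c = 0" if "c \<in> D" for c
          using a b that DI Hall_coeff_eq_0_iff[of a b c] unfolding Q_def by blast
        then show ?thesis
          unfolding weighted_form_def using a b
          by (intro sum.neutral) (simp add: lookup_Hall_mult_basis)
      qed
      finally show "Hall_form (Poly_Mapping.keys q) q (Hall_mult_basis C a b) = 0" .
    qed
    then have "p + q \<in> S" using pS V sub hall.subspace_add by blast
    then show ?thesis by (simp add: q_def)
  qed
qed

theorem hull_Hall_primitives: "Hall_subalgebra C hull Hall_primitives C = Hall_space C"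
proof (rule hull_unique)
  show "Hall_primitives C \<subseteq> Hall_space C" unfolding Hall_primitives_def by blast
  show "Hall_subalgebra C (Hall_space C)" by (rule Hall_subalgebra_Hall_space)
  fix S assume S: "Hall_primitives C \<subseteq> S" "Hall_subalgebra C S"
  then have sub: "hall.subspace S" unfolding Hall_subalgebra_def by blast
  show "Hall_space C \<subseteq> S"
  proof
    fix v assume "v \<in> Hall_space C"
    then have "(\<Sum>a\<in>Poly_Mapping.keys v. scale (Poly_Mapping.lookup v a) (Poly_Mapping.single a 1)) \<in> S"
      unfolding Hall_space_def using single_in_Hall_subalgebra[OF S(2,1)]
      by (intro hall.subspace_sum[OF sub] hall.subspace_scale[OF sub]) auto
    then show "v \<in> S" by (simp add: single_decomposition)
  qed
qed

section \<open>Minimality of the space of primitive elements\<close>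

lemma Hall_mult_augmentation:
  assumes "v \<in> Hall_space C" "Poly_Mapping.lookup v (zero_class C) = 0"
    and "w \<in> Hall_space C" "Poly_Mapping.lookup w (zero_class C) = 0"
  shows "Hall_mult C v w \<in> Hall_space C" "Poly_Mapping.lookup (Hall_mult C v w) (zero_class C) = 0"
proof -
  let ?z = "zero_class C"
  have keys: "a \<in> Iso C - {?z}" if "a \<in> Poly_Mapping.keys v \<or> a \<in> Poly_Mapping.keys w" for a
    using that assms unfolding Hall_space_def by (auto simp: in_keys_iff)
  show "Hall_mult C v w \<in> Hall_space C"
    using Hall_subalgebra_Hall_space assms unfolding Hall_subalgebra_def by blast
  have "hall.subspace {u. Poly_Mapping.lookup u ?z = 0}" by (simp add: hall.subspace_def lookup_add)
  \<comment> \<open>A zero middle term has zero ends, so the zero class does not occur in a product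
    of non-zero classes.\<close>
  moreover have "Hall_mult_basis C a b \<in> {u. Poly_Mapping.lookup u ?z = 0}"
    if "a \<in> Poly_Mapping.keys v" "b \<in> Poly_Mapping.keys w" for a b
    using keys[of a] keys[of b] that Ext1_zero_class[of a b] Hall_coeff_eq_0_iff[of a b ?z] zero_class_Iso
    by (auto simp: lookup_Hall_mult_basis)
  ultimately have "Hall_mult C v w \<in> {u. Poly_Mapping.lookup u ?z = 0}"
    by (rule Hall_mult_in_subspace)
  then show "Poly_Mapping.lookup (Hall_mult C v w) ?z = 0" by simp
qed

text \<open>The empty list would give the unit, which is not in the augmentation ideal; a single
  factor is recovered by the right unit law.\<close>

lemma primitive_foldr_augmentation:
  assumes "set vs \<subseteq> Hall_primitives C" "vs \<noteq> []"
  shows "foldr (Hall_mult C) vs (Hall_one C) \<in> Hall_space C \<and>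
    Poly_Mapping.lookup (foldr (Hall_mult C) vs (Hall_one C)) (zero_class C) = 0"
  using assms
proof (induction vs)
  case (Cons v vs)
  then have v: "v \<in> Hall_space C" "Poly_Mapping.lookup v (zero_class C) = 0"
    using Hall_primitives_iff[of v] unfolding Hall_primitives_def by auto
  show ?case
  proof (cases "vs = []")
    case True
    then show ?thesis using v by (simp add: Hall_mult_one_right)
  next
    case False
    then show ?thesis using v Cons Hall_mult_augmentation by simp
  qed
qed simp

text \<open>After the first factor at least one more remains, so both the first factor and the
  product of the others lie in the augmentation ideal. Their product thus expands into products of
  two non-zero classes, to which \<open>u\<close> is orthogonal.\<close>

lemma primitive_orthogonal_foldr:
  assumes u: "u \<in> Hall_primitives C" and vs: "set vs \<subseteq> Hall_primitives C" "length vs \<ge> 2"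
  shows "Hall_form (Poly_Mapping.keys u) u (foldr (Hall_mult C) vs (Hall_one C)) = 0"
proof -
  let ?z = "zero_class C"
  obtain v vs' where vs': "vs = v # vs'" "vs' \<noteq> []" using vs(2) by (cases vs) force+
  let ?w = "foldr (Hall_mult C) vs' (Hall_one C)"
  have v: "v \<in> Hall_space C" "Poly_Mapping.lookup v ?z = 0"
    using vs vs' Hall_primitives_iff[of v] unfolding Hall_primitives_def by auto
  have w: "?w \<in> Hall_space C" "Poly_Mapping.lookup ?w ?z = 0"
    using primitive_foldr_augmentation vs vs' by auto
  have uH: "u \<in> Hall_space C" using u unfolding Hall_primitives_def by blast
  have "Hall_mult C v ?w \<in> {y. Hall_form (Poly_Mapping.keys u) u y = 0}"
  proof (rule Hall_mult_in_subspace[OF subspace_weighted_form])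
    fix a b assume "a \<in> Poly_Mapping.keys v" "b \<in> Poly_Mapping.keys ?w"
    then have "a \<in> Iso C - {?z}" "b \<in> Iso C - {?z}"
      using v w unfolding Hall_space_def by (auto simp: in_keys_iff)
    then show "Hall_mult_basis C a b \<in> {y. Hall_form (Poly_Mapping.keys u) u y = 0}"
      using u Hall_primitives_iff[OF uH] by blast
  qed
  then show ?thesis using vs' by simp
qed

text \<open>A primitive element in this span is orthogonal to itself, and over its own support the
  form has strictly positive weights.\<close>

theorem Hall_primitives_minimal:
  "Hall_primitives C \<inter> hall.span (\<Union>r \<in> {2..}. Hall_power C (Hall_primitives C) r) = {0}"
proof
  show "Hall_primitives C \<inter> hall.span (\<Union>r \<in> {2..}. Hall_power C (Hall_primitives C) r) \<subseteq> {0}"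
  proof
    fix u assume "u \<in> Hall_primitives C \<inter> hall.span (\<Union>r \<in> {2..}. Hall_power C (Hall_primitives C) r)"
    then have u: "u \<in> Hall_primitives C" "u \<in> hall.span (\<Union>r \<in> {2..}. Hall_power C (Hall_primitives C) r)"
      by auto
    have "Hall_form (Poly_Mapping.keys u) u t = 0" if "r \<ge> 2" "t \<in> Hall_power C (Hall_primitives C) r" for r t
      by (rule weighted_form_orthogonal_span[OF that(2)[unfolded Hall_power_def]])
        (use primitive_orthogonal_foldr[OF u(1)] that(1) in auto)
    then have 0: "Hall_form (Poly_Mapping.keys u) u u = 0"
      by (intro weighted_form_orthogonal_span[OF u(2)]) auto
    have "Poly_Mapping.keys u = {}"
    proof (rule ccontr)
      assume "Poly_Mapping.keys u \<noteq> {}"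
      then obtain c where c: "c \<in> Poly_Mapping.keys u" by blast
      have "1 / aut c * Poly_Mapping.lookup u c = 0"
        by (rule weighted_form_self_eq_0[OF _ _ 0 c]) auto
      moreover have "c \<in> Iso C" using c u(1) unfolding Hall_primitives_def Hall_space_def by blast
      ultimately show False using c aut_pos by (fastforce simp: in_keys_iff)
    qed
    then show "u \<in> {0}" by simp
  qed
  have "(0 :: 'o set \<Rightarrow>\<^sub>0 rat) \<in> Hall_space C" by (simp add: Hall_space_def)
  then have "0 \<in> Hall_primitives C"
    by (simp add: Hall_primitives_def Hall_comult_def tensor_def)
  then show "{0} \<subseteq> Hall_primitives C \<inter> hall.span (\<Union>r \<in> {2..}. Hall_power C (Hall_primitives C) r)"
    using hall.span_zero by blast
qed

end

theorem theorem1p2: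
  fixes \<A> :: "('o, 'm) exact_category"
  assumes "exact_category \<A>" and "profinitary \<A>" and "cofinitary \<A>"
  shows "Hall_subalgebra \<A> hull Hall_primitives \<A> = Hall_space \<A> \<and>
    Hall_primitives \<A> \<inter> hall.span (\<Union>r \<in> {2..}. Hall_power \<A> (Hall_primitives \<A>) r) = {0}"
proof -
  interpret finitary_exact_category \<A>
    using assms by (intro finitary_exact_category.intro finitary_exact_category_axioms.intro)
  show ?thesis using hull_Hall_primitives Hall_primitives_minimal by blast
qed

end
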